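(* Let $n\ge1$, let $M(n)=(n+2)^{\frac{1}{2n}}\left(\frac{n+2}{n+1}\right)^{\frac{n+1}{2n}}$, and let $\varphi:\mathbb{B}^n\to\mathbb{B}^n$ be a holomorphic mapping. Suppose that there are constants $r\in(0,1/M(n))$ and $\epsilon>0$ such that for each $w\in\mathbb{B}^n$ there is a point $z_w\in\mathbb{B}^n$ satisfying $$\tanh\beta(\varphi(z_w),w)<r^n\quad\text{and}\quad \tau_{\varphi,n}(z_w)>\epsilon.$$ Then there exists a constant $k(n,r,\epsilon)>0$, depending only on $r$, $\epsilon$ and $n$, such that $$\|C_\varphi f\|_{P(n,1)}\geq k(n,r,\epsilon)\,\|f\|_{P(n,1)}\quad\text{for all } f\in\mathcal{B}_{P(n,1)}.$$
   Context: $\mathbb{B}^n=\{z\in\mathbb{C}^n:|z|<1\}$ is the open unit ball of $\mathbb{C}^n$ ($n\ge1$) with the standard Hermitian inner product $\langle z,w\rangle=\sum_i z_i\overline{w_i}$ and Euclidean norm $|z|$. A mapping $f:\mathbb{B}^n\to\mathbb{C}^n$ is pluriharmonic if it is twice continuously differentiable and $\frac{\partial^2 f}{\partial z_i\partial\overline{z}_j}=0$ on $\mathbb{B}^n$ for all $i,j=1,\dots,n$ (componentwise). $\mathcal{H}(\mathbb{B}^n,\mathbb{C}^n)$ denotes the set of all such mappings. Every $f\in\mathcal{H}(\mathbb{B}^n,\mathbb{C}^n)$ can be written as $f=h+\overline{g}$ with $h,g:\mathbb{B}^n\to\mathbb{C}^n$ holomorphic, uniquely if $g(0)=0$. Let $Dh(z),Dg(z)$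 be the complex $n\times n$ Jacobian matrices. Define $$\Lambda_f(z)=|\det Dh(z)|+|\det Dg(z)|,\qquad D_f^{n,1}(z)=(1-|z|^2)^{\frac{n+1}{2n}}\Lambda_f(z)^{\frac1n},\qquad \|f\|_{P(n,1)}=\sup_{z\in\mathbb{B}^n}D_f^{n,1}(z).$$ $\mathcal{B}_{P(n,1)}$ is the set of $f\in\mathcal{H}(\mathbb{B}^n,\mathbb{C}^n)$ with $\|f\|_{P(n,1)}<\infty$ (the quantity $\|\cdot\|_{P(n,1)}$ is only called a prenorm; no linear structure is assumed). For a holomorphic self-map $\varphi$ of $\mathbb{B}^n$, the composition operator is $C_\varphi f=f\circ\varphi$ for $f\in\mathcal{H}(\mathbb{B}^n,\mathbb{C}^n)$, and $$\tau_{\varphi,n}(z)=\left(\frac{1-|z|^2}{1-|\varphi(z)|^2}\right)^{\frac{n+1}{2n}}|\det D\varphi(z)|^{\frac1n},\qquad z\in\mathbb{B}^n.$$ Bergman metric: for $z\in\mathbb{B}^n$ let $B(z)=\frac{(1-|z|^2)I+A(z)}{(1-|z|^2)^2}$, where $I$ is the $n\times n$ identity matrix and $A(z)=(z_i\overline{z}_j)_{i,j}$. Then $\beta(z,w)=\inf_\gamma\int_0^1\langle B(\gamma(t))\gamma'(t),\gamma'(t)\rangle^{1/2}\,dt$, the infimum being over piecewise smooth curves $\gamma:[0,1]\to\mathbb{B}^n$ connecting $z$ and $w$. Equivalently, $\tanh\beta(z,w)=|\varphi_z(w)|$, where $\varphi_z$ is the involutive automorphism of $\mathbb{B}^n$ interchanging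 $0$ and $z$: $$\varphi_z(w)=\frac{z-P_zw-\sqrt{1-|z|^2}\,Q_zw}{1-\langle w,z\rangle},$$ with $P_z$ the orthogonal projection of $\mathbb{C}^n$ onto the span of $z$ and $Q_z=I-P_z$. *)

theory Defs
  imports "HOL-Analysis.Analysis"
begin

text \<open>
  The space $\mathbb C^n$ is \<open>complex ^ 'n\<close> with $n$ = \<open>CARD('n)\<close>; its library norm is the
  Euclidean norm, so the unit ball is \<open>ball 0 1\<close>.
\<close>

abbreviation unit_ball :: "(complex ^ 'n) set"
  where "unit_ball \<equiv> ball 0 1"

definition hinner :: "complex ^ 'n \<Rightarrow> complex ^ 'n \<Rightarrow> complex"
  where "hinner z w = (\<Sum>i\<in>UNIV. z $ i * cnj (w $ i))"

definition vcnj :: "complex ^ 'n \<Rightarrow> complex ^ 'n"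
  where "vcnj z = (\<chi> i. cnj (z $ i))"


section \<open>Holomorphic and pluriharmonic mappings\<close>

text \<open>
  Derivatives in the library are real-linear. A map is holomorphic when its derivative is
  complex-linear, that is, given by a complex matrix.
\<close>

definition holomorphic_map_on ::
    "(complex ^ 'n \<Rightarrow> complex ^ 'n) \<Rightarrow> (complex ^ 'n) set \<Rightarrow> bool"
  where "holomorphic_map_on f S \<longleftrightarrow>
    (\<forall>z\<in>S. \<exists>A :: complex ^ 'n ^ 'n. (f has_derivative (\<lambda>v. A *v v)) (at z))"

definition cjacobian ::
    "(complex ^ 'n \<Rightarrow> complex ^ 'n) \<Rightarrow> complex ^ 'n \<Rightarrow> complex ^ 'n ^ 'n"
  where "cjacobian h z = matrix (frechet_derivative h (at z))"

definition C2_on ::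
    "('a::real_normed_vector \<Rightarrow> 'b::real_normed_vector) \<Rightarrow> 'a set \<Rightarrow> bool"
  where "C2_on f S \<longleftrightarrow>
    (\<exists>(f' :: 'a \<Rightarrow> 'a \<Rightarrow>\<^sub>L 'b) (f'' :: 'a \<Rightarrow> 'a \<Rightarrow>\<^sub>L ('a \<Rightarrow>\<^sub>L 'b)).
      (\<forall>z\<in>S. (f has_derivative blinfun_apply (f' z)) (at z)) \<and>
      (\<forall>z\<in>S. (f' has_derivative blinfun_apply (f'' z)) (at z)) \<and>
      continuous_on S f'')"

text \<open>
  The Wirtinger derivatives: with $z_i = x_i + \mathrm{i} y_i$, the real partial derivatives
  in $x_i$ and $y_i$ are the derivatives in the directions \<open>axis i 1\<close> and \<open>axis i \<i>\<close>.
\<close>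

definition wirtinger :: "'n \<Rightarrow> (complex ^ 'n \<Rightarrow> complex) \<Rightarrow> complex ^ 'n \<Rightarrow> complex"
  where "wirtinger i u z =
    (frechet_derivative u (at z) (axis i 1) - \<i> * frechet_derivative u (at z) (axis i \<i>)) / 2"

definition wirtinger_bar :: "'n \<Rightarrow> (complex ^ 'n \<Rightarrow> complex) \<Rightarrow> complex ^ 'n \<Rightarrow> complex"
  where "wirtinger_bar i u z =
    (frechet_derivative u (at z) (axis i 1) + \<i> * frechet_derivative u (at z) (axis i \<i>)) / 2"

definition pluriharmonic :: "(complex ^ 'n \<Rightarrow> complex ^ 'n) \<Rightarrow> bool"
  where "pluriharmonic f \<longleftrightarrow>
    C2_on f unit_ball \<and>
    (\<forall>z\<in>unit_ball. \<forall>i j k. wirtinger i (wirtinger_bar j (\<lambda>x. f x $ k)) z = 0)"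


section \<open>The Bloch-type prenorm\<close>

definition canonical_decomposition ::
    "(complex ^ 'n \<Rightarrow> complex ^ 'n) \<Rightarrow> (complex ^ 'n \<Rightarrow> complex ^ 'n) \<Rightarrow>
     (complex ^ 'n \<Rightarrow> complex ^ 'n) \<Rightarrow> bool"
  where "canonical_decomposition f h g \<longleftrightarrow>
    holomorphic_map_on h unit_ball \<and> holomorphic_map_on g unit_ball \<and> g 0 = 0 \<and>
    (\<forall>z\<in>unit_ball. f z = h z + vcnj (g z))"

text \<open>
  For pluriharmonic \<open>f\<close> the decomposition exists and is unique on the unit ball. Being total
  functions, \<open>h\<close> and \<open>g\<close> are arbitrary outside the ball, so the pair is picked by \<open>SOME\<close>
  rather than \<open>THE\<close>; the value of \<open>Lambda f z\<close> for \<open>z\<close> in the ball does not depend on the choice.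
\<close>

definition Lambda :: "(complex ^ 'n \<Rightarrow> complex ^ 'n) \<Rightarrow> complex ^ 'n \<Rightarrow> real"
  where "Lambda f z =
    (let (h, g) = (SOME (h, g). canonical_decomposition f h g)
     in norm (det (cjacobian h z)) + norm (det (cjacobian g z)))"

definition bloch_density :: "(complex ^ 'n \<Rightarrow> complex ^ 'n) \<Rightarrow> complex ^ 'n \<Rightarrow> real"
  where "bloch_density f z =
    (1 - (norm z)\<^sup>2) powr ((real CARD('n) + 1) / (2 * real CARD('n))) *
    Lambda f z powr (1 / real CARD('n))"

text \<open>The supremum may be infinite, hence the value in \<open>ennreal\<close>.\<close>

definition bloch_prenorm :: "(complex ^ 'n \<Rightarrow> complex ^ 'n) \<Rightarrow> ennreal"
  where "bloch_prenorm f = (SUP z\<in>unit_ball. ennreal (bloch_density f z))"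

definition bloch_space :: "(complex ^ 'n \<Rightarrow> complex ^ 'n) set"
  where "bloch_space = {f. pluriharmonic f \<and> bloch_prenorm f < \<infinity>}"


section \<open>Composition operators\<close>

definition comp_op ::
    "(complex ^ 'n \<Rightarrow> complex ^ 'n) \<Rightarrow> (complex ^ 'n \<Rightarrow> complex ^ 'n) \<Rightarrow>
     complex ^ 'n \<Rightarrow> complex ^ 'n"
  where "comp_op \<phi> f = f \<circ> \<phi>"

definition tau :: "(complex ^ 'n \<Rightarrow> complex ^ 'n) \<Rightarrow> complex ^ 'n \<Rightarrow> real"
  where "tau \<phi> z =
    ((1 - (norm z)\<^sup>2) / (1 - (norm (\<phi> z))\<^sup>2))
      powr ((real CARD('n) + 1) / (2 * real CARD('n))) *
    norm (det (cjacobian \<phi> z)) powr (1 / real CARD('n))"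


section \<open>The Bergman metric\<close>

definition bergman_matrix :: "complex ^ 'n \<Rightarrow> complex ^ 'n ^ 'n"
  where "bergman_matrix z =
    (\<chi> i j. (complex_of_real (1 - (norm z)\<^sup>2) * (if i = j then 1 else 0) + z $ i * cnj (z $ j)) /
             complex_of_real ((1 - (norm z)\<^sup>2)\<^sup>2))"

text \<open>
  Piecewise smooth means continuously differentiable, up to and including the endpoints (with
  one-sided derivatives there), on each closed piece of a finite partition \<open>P\<close> of the unit
  interval; continuity on the whole interval follows. The library's \<open>valid_path\<close> is not used
  because it allows the derivative to be unbounded near the partition points; such a curve may have
  infinite length, and the library integral of its speed would then be \<open>0\<close>.
\<close>

definition piecewise_smooth_curve :: "(real \<Rightarrow> 'a::real_normed_vector) \<Rightarrow> bool"
  where "piecewise_smooth_curve \<gamma> \<longleftrightarrow>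
    (\<exists>P. finite P \<and> {0, 1} \<subseteq> P \<and> P \<subseteq> {0..1} \<and>
      (\<forall>a\<in>P. \<forall>b\<in>P. a < b \<and> {a<..<b} \<inter> P = {} \<longrightarrow>
        (\<exists>\<gamma>'. continuous_on {a..b} \<gamma>' \<and>
          (\<forall>t\<in>{a..b}. (\<gamma> has_vector_derivative \<gamma>' t) (at t within {a..b})))))"

text \<open>
  \<open>bergman_matrix z\<close> is Hermitian and positive definite, so the form below is real and the real part
  only changes the type. The unspecified values of \<open>vector_derivative\<close> at the finitely many
  partition points do not affect the integral.
\<close>

definition bergman_length :: "(real \<Rightarrow> complex ^ 'n) \<Rightarrow> real"
  where "bergman_length \<gamma> =
    integral {0..1} (\<lambda>t. sqrt (Re (hinner
      (bergman_matrix (\<gamma> t) *v vector_derivative \<gamma> (at t)) (vector_derivative \<gamma> (at t)))))"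

definition bergman_dist :: "complex ^ 'n \<Rightarrow> complex ^ 'n \<Rightarrow> real"
  where "bergman_dist z w =
    Inf {bergman_length \<gamma> | \<gamma>. piecewise_smooth_curve \<gamma> \<and> \<gamma> ` {0..1} \<subseteq> unit_ball \<and>
                              \<gamma> 0 = z \<and> \<gamma> 1 = w}"


definition M_const :: "nat \<Rightarrow> real"
  where "M_const n =
    (real n + 2) powr (1 / (2 * real n)) *
    ((real n + 2) / (real n + 1)) powr ((real n + 1) / (2 * real n))"

end

theory Submission imports Defs "HOL-Complex_Analysis.Riemann_Mapping" begin

text \<open>
  Since \<open>\<Lambda>\<^bsub>f \<circ> \<phi>\<^esub> = (\<Lambda>\<^bsub>f\<^esub> \<circ> \<phi>) |det D\<phi>|\<close>, the Bloch density of \<open>f \<circ> \<phi>\<close> at \<open>z\<close> is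
  \<open>tau \<phi> z\<close> times the density of \<open>f\<close> at \<open>\<phi> z\<close>. So it suffices that the density of \<open>f\<close> cannot drop too
  fast: if it almost attains its supremum at \<open>w\<close>, it stays comparable to it at every point \<open>u\<close> with
  \<open>tanh (\<beta>(u, w)) < r\<^sup>n\<close>. Choose a unimodular \<open>c\<close> for which the holomorphic function
  \<open>F = det Dh + c det Dg\<close> satisfies \<open>|F(w)| = \<Lambda>\<^bsub>f\<^esub>(w)\<close>; then \<open>|F| \<le> \<Lambda>\<^bsub>f\<^esub>\<close> everywhere. Restricting \<open>F\<close> to
  the complex line through \<open>u\<close> and \<open>w\<close>, which meets the ball in a disc, and moving \<open>w\<close> to the centre
  by a Moebius map, one is left with a function on the disc bounded by \<open>(1 - |\<zeta>|\<^sup>2)\<close> to the power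
  \<open>- (n + 1) / 2\<close>. The Schwarz lemma on the disc of radius \<open>s\<close> bounds it from below when
  \<open>|\<zeta>| < s (1 - s\<^sup>2)\<close> to the power \<open>(n + 1) / 2\<close>; the maximum of the right-hand side, attained at
  \<open>s\<^sup>2 = 1 / (n + 2)\<close>, is \<open>M(n)\<close> to the power \<open>- n\<close>.
\<close>

section \<open>Exactness of closed one-forms\<close>

text \<open>The mean value theorem is applied twice, first in the direction \<open>a\<close> and
  then in the direction \<open>b\<close>. Pairing with \<open>c\<close> makes the second difference
  real-valued, because the theorem has no exact form for vector values.\<close>

lemma second_difference_mean_value:
  fixes f :: "'a::real_normed_vector \<Rightarrow> 'b::real_inner"
    and f' :: "'a \<Rightarrow> 'a \<Rightarrow>\<^sub>L 'b" and f'' :: "'a \<Rightarrow> 'a \<Rightarrow>\<^sub>L ('a \<Rightarrow>\<^sub>L 'b)"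
  assumes f': "\<And>y. y \<in> S \<Longrightarrow> (f has_derivative blinfun_apply (f' y)) (at y)"
    and f'': "\<And>y. y \<in> S \<Longrightarrow> (f' has_derivative blinfun_apply (f'' y)) (at y)"
    and s: "0 < s" and in_S: "\<And>u v. \<lbrakk>u \<in> {0..s}; v \<in> {0..s}\<rbrakk> \<Longrightarrow> x + u *\<^sub>R a + v *\<^sub>R b \<in> S"
  obtains u v where "u \<in> {0<..<s}" "v \<in> {0<..<s}"
    "(f (x + s *\<^sub>R a + s *\<^sub>R b) - f (x + s *\<^sub>R a) - f (x + s *\<^sub>R b) + f x) \<bullet> c =
     s\<^sup>2 * (f'' (x + u *\<^sub>R a + v *\<^sub>R b) b a \<bullet> c)"
proof -
  let ?p = "\<lambda>u v. x + u *\<^sub>R a + v *\<^sub>R b"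
  define g where "g u = (f (?p u s) - f (?p u 0)) \<bullet> c" for u
  have g: "(g has_derivative (\<lambda>h. h * ((f' (?p u s) a - f' (?p u 0) a) \<bullet> c))) (at u)"
    if "u \<in> {0..s}" for u
  proof -
    have *: "((\<lambda>u. f (?p u v)) has_derivative (\<lambda>h. f' (?p u v) (h *\<^sub>R a))) (at u)"
      if "v \<in> {0..s}" for v
      by (rule has_derivative_compose[where f = "\<lambda>u. ?p u v" and g = f])
         (use f' in_S \<open>u \<in> {0..s}\<close> that in \<open>auto intro!: derivative_eq_intros\<close>)
    show ?thesis
      unfolding g_def
      by (rule has_derivative_eq_rhs, rule derivative_intros, rule has_derivative_diff[OF *[of s] *[of 0]])
         (use s in \<open>auto simp: blinfun.scaleR_right algebra_simps inner_diff_left\<close>)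
  qed
  obtain u where u: "u \<in> {0<..<s}" "g s - g 0 = s * ((f' (?p u s) a - f' (?p u 0) a) \<bullet> c)"
    using mvt_simple[OF s has_derivative_at_withinI[OF g]] by auto
  define k where "k v = f' (?p u v) a \<bullet> c" for v
  have k: "(k has_derivative (\<lambda>h. h * (f'' (?p u v) b a \<bullet> c))) (at v)"
    if "v \<in> {0..s}" for v
  proof -
    have *: "((\<lambda>v. f' (?p u v)) has_derivative (\<lambda>h. f'' (?p u v) (h *\<^sub>R b))) (at v)"
      by (rule has_derivative_compose[where f = "\<lambda>v. ?p u v" and g = f'])
         (use f'' in_S u that in \<open>auto intro!: derivative_eq_intros\<close>)
    show ?thesis
      unfolding k_def
      by (rule derivative_eq_intros * refl)+ (auto simp: blinfun.scaleR_right blinfun.scaleR_left)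
  qed
  obtain v where v: "v \<in> {0<..<s}" "k s - k 0 = s * (f'' (?p u v) b a \<bullet> c)"
    using mvt_simple[OF s has_derivative_at_withinI[OF k]] by auto
  have "(f (?p s s) - f (?p s 0) - f (?p 0 s) + f x) \<bullet> c = g s - g 0"
    by (simp add: g_def algebra_simps inner_diff_left inner_add_left)
  also have "\<dots> = s\<^sup>2 * (f'' (?p u v) b a \<bullet> c)"
    using u(2) v(2) by (simp add: k_def power2_eq_square inner_diff_left)
  finally show thesis
    using that[OF u(1) v(1)] by simp
qed

text \<open>The second difference over a small parallelogram does not change when \<open>a\<close>
  and \<open>b\<close> are exchanged, so it is \<open>s\<^sup>2\<close> times a value of either
  mixed derivative near \<open>x\<close>. Continuity of \<open>f''\<close> carries the equality over
  to \<open>x\<close>.\<close>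

lemma second_derivative_symmetric:
  fixes f :: "'a::real_normed_vector \<Rightarrow> 'b::real_inner"
    and f' :: "'a \<Rightarrow> 'a \<Rightarrow>\<^sub>L 'b" and f'' :: "'a \<Rightarrow> 'a \<Rightarrow>\<^sub>L ('a \<Rightarrow>\<^sub>L 'b)"
  assumes "open S" "x \<in> S"
    and f': "\<And>y. y \<in> S \<Longrightarrow> (f has_derivative blinfun_apply (f' y)) (at y)"
    and f'': "\<And>y. y \<in> S \<Longrightarrow> (f' has_derivative blinfun_apply (f'' y)) (at y)"
    and cont: "continuous_on S f''"
  shows "f'' x a b = f'' x b a"
proof (rule ccontr)
  assume neq: "f'' x a b \<noteq> f'' x b a"
  \<comment> \<open>Testing against the defect of symmetry itself makes \<open>d\<close> positive;
    each of the two nearby values is then allowed an error below \<open>d / 2\<close>.\<close>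
  define c where "c = f'' x a b - f'' x b a"
  define d where "d = (f'' x a b - f'' x b a) \<bullet> c"
  have d: "d > 0" using neq by (simp add: d_def c_def)
  have "isCont f'' x"
    using assms(1,2) cont by (simp add: continuous_on_eq_continuous_at)
  then have 1: "isCont (\<lambda>y. f'' y a b \<bullet> c) x" and 2: "isCont (\<lambda>y. f'' y b a \<bullet> c) x"
    by (auto intro!: continuous_intros)
  obtain e1 where e1: "e1 > 0" "\<And>y. dist y x < e1 \<Longrightarrow> \<bar>f'' y a b \<bullet> c - f'' x a b \<bullet> c\<bar> < d / 2"
    using 1[unfolded continuous_at_eps_delta] d by (metis dist_real_def half_gt_zero)
  obtain e2 where e2: "e2 > 0" "\<And>y. dist y x < e2 \<Longrightarrow> \<bar>f'' y b a \<bullet> c - f'' x b a \<bullet> c\<bar> < d / 2"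
    using 2[unfolded continuous_at_eps_delta] d by (metis dist_real_def half_gt_zero)
  obtain e3 where e3: "e3 > 0" "ball x e3 \<subseteq> S"
    using assms(1,2) open_contains_ball by blast
  define e where "e = min e1 (min e2 e3)"
  have e: "e > 0" using e1 e2 e3 by (simp add: e_def)
  \<comment> \<open>This keeps the parallelogram spanned by \<open>s *\<^sub>R a\<close> and
    \<open>s *\<^sub>R b\<close> within distance \<open>e\<close> of \<open>x\<close>; the summand 1
    makes the denominator positive and the estimate strict.\<close>
  define s where "s = e / (2 * (norm a + norm b + 1))"
  have pos: "norm a + norm b + 1 > 0" by (smt (verit) norm_ge_zero)
  have s: "s > 0" using e pos by (simp add: s_def)
  have near: "dist (x + u *\<^sub>R p + v *\<^sub>R q) x < e"
    if "u \<in> {0..s}" "v \<in> {0..s}" "p = a \<and> q = b \<or> p = b \<and> q = a" for u v p q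
  proof -
    have "dist (x + u *\<^sub>R p + v *\<^sub>R q) x = norm (u *\<^sub>R p + v *\<^sub>R q)"
      by (simp add: dist_norm add.assoc)
    also have "\<dots> \<le> norm (u *\<^sub>R p) + norm (v *\<^sub>R q)" by (rule norm_triangle_ineq)
    also have "\<dots> \<le> s * norm p + s * norm q"
      using that by (intro add_mono) (auto intro!: mult_right_mono)
    also have "\<dots> \<le> s * (norm a + norm b + 1)"
      using that s by (auto simp: algebra_simps)
    also have "\<dots> < e" using pos e by (simp add: s_def divide_simps)
    finally show ?thesis .
  qed
  have in_S: "x + u *\<^sub>R p + v *\<^sub>R q \<in> S"
    if "u \<in> {0..s}" "v \<in> {0..s}" "p = a \<and> q = b \<or> p = b \<and> q = a" for u v p q
    using near[OF that] e3(2) by (auto simp: e_def dist_commute subset_iff)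
  obtain u v where uv: "u \<in> {0<..<s}" "v \<in> {0<..<s}"
    "(f (x + s *\<^sub>R a + s *\<^sub>R b) - f (x + s *\<^sub>R a) - f (x + s *\<^sub>R b) + f x) \<bullet> c =
     s\<^sup>2 * (f'' (x + u *\<^sub>R a + v *\<^sub>R b) b a \<bullet> c)"
    using second_difference_mean_value[OF f' f'' s, of S x a b c] in_S by blast
  obtain u' v' where uv': "u' \<in> {0<..<s}" "v' \<in> {0<..<s}"
    "(f (x + s *\<^sub>R b + s *\<^sub>R a) - f (x + s *\<^sub>R b) - f (x + s *\<^sub>R a) + f x) \<bullet> c =
     s\<^sup>2 * (f'' (x + u' *\<^sub>R b + v' *\<^sub>R a) a b \<bullet> c)"
    using second_difference_mean_value[OF f' f'' s, of S x b a c] in_S by blast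
  have "x + s *\<^sub>R b + s *\<^sub>R a = x + s *\<^sub>R a + s *\<^sub>R b" by (simp add: algebra_simps)
  then have "s\<^sup>2 * (f'' (x + u *\<^sub>R a + v *\<^sub>R b) b a \<bullet> c) = s\<^sup>2 * (f'' (x + u' *\<^sub>R b + v' *\<^sub>R a) a b \<bullet> c)"
    using uv(3) uv'(3) by (simp add: algebra_simps)
  then have "f'' (x + u *\<^sub>R a + v *\<^sub>R b) b a \<bullet> c = f'' (x + u' *\<^sub>R b + v' *\<^sub>R a) a b \<bullet> c"
    using s by simp
  moreover have "\<bar>f'' (x + u *\<^sub>R a + v *\<^sub>R b) b a \<bullet> c - f'' x b a \<bullet> c\<bar> < d / 2"
    using near[of u v a b] uv by (intro e2) (auto simp: e_def)
  moreover have "\<bar>f'' (x + u' *\<^sub>R b + v' *\<^sub>R a) a b \<bullet> c - f'' x a b \<bullet> c\<bar> < d / 2"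
    using near[of u' v' b a] uv' by (intro e1) (auto simp: e_def)
  moreover have "d = f'' x a b \<bullet> c - f'' x b a \<bullet> c"
    by (simp add: d_def inner_diff_left)
  ultimately show False
    by (smt (verit) field_sum_of_halves)
qed

text \<open>The Poincare lemma: the primitive at \<open>x\<close> is the integral of
  \<open>\<omega> (t *\<^sub>R x) x\<close> over \<open>t\<close> from 0 to 1. Differentiated under
  the integral sign, its integrand becomes, by symmetry of \<open>\<omega>'\<close>, the
  \<open>t\<close>-derivative of \<open>t *\<^sub>R \<omega> (t *\<^sub>R x)\<close>, whose integral
  is \<open>\<omega> x\<close>.\<close>

lemma closed_one_form_exact:
  fixes \<omega> :: "'a::banach \<Rightarrow> 'a \<Rightarrow>\<^sub>L 'b::banach" and \<omega>' :: "'a \<Rightarrow> 'a \<Rightarrow>\<^sub>L ('a \<Rightarrow>\<^sub>L 'b)"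
  assumes "open S" "convex S" "0 \<in> S"
    and \<omega>: "\<And>x. x \<in> S \<Longrightarrow> (\<omega> has_derivative blinfun_apply (\<omega>' x)) (at x)"
    and cont: "continuous_on S \<omega>'"
    and sym: "\<And>x a b. x \<in> S \<Longrightarrow> \<omega>' x a b = \<omega>' x b a"
  obtains H where "\<And>x. x \<in> S \<Longrightarrow> (H has_derivative blinfun_apply (\<omega> x)) (at x)"
proof -
  define F where "F x t = \<omega> (t *\<^sub>R x) x" for x and t :: real
  define F' where "F' x t = t *\<^sub>R \<omega>' (t *\<^sub>R x) x + \<omega> (t *\<^sub>R x)" for x and t :: real
  have in_S: "t *\<^sub>R x \<in> S" if "x \<in> S" "t \<in> {0..1}" for x t
    using convexD_alt[OF assms(2,3) that(1), of t] that(2) by simp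
  have cont\<omega>: "continuous_on S \<omega>"
    using \<omega> by (meson continuous_at_imp_continuous_on has_derivative_continuous)
  have dF: "((\<lambda>x. F x t) has_derivative blinfun_apply (F' x t)) (at x)"
    if "x \<in> S" "t \<in> {0..1}" for x t
  proof -
    have *: "((\<lambda>x. \<omega> (t *\<^sub>R x)) has_derivative (\<lambda>h. \<omega>' (t *\<^sub>R x) (t *\<^sub>R h))) (at x)"
      by (rule has_derivative_compose[where f = "\<lambda>x. t *\<^sub>R x" and g = \<omega>])
         (use \<omega> in_S that in \<open>auto intro!: derivative_eq_intros\<close>)
    show ?thesis
      unfolding F_def F'_def
      by (rule derivative_eq_intros * refl)+
         (use in_S[OF that] in \<open>auto simp: blinfun.scaleR_right blinfun.scaleR_left
           blinfun.add_left fun_eq_iff sym\<close>)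
  qed
  have int: "(F' x has_integral \<omega> x) {0..1}" if x: "x \<in> S" for x
  proof -
    have "(F' x has_integral 1 *\<^sub>R \<omega> (1 *\<^sub>R x) - 0 *\<^sub>R \<omega> (0 *\<^sub>R x)) {0..1}"
    proof (rule fundamental_theorem_of_calculus)
      fix t :: real assume t: "t \<in> {0..1}"
      have *: "((\<lambda>t. \<omega> (t *\<^sub>R x)) has_derivative (\<lambda>h. \<omega>' (t *\<^sub>R x) (h *\<^sub>R x))) (at t)"
        by (rule has_derivative_compose[where f = "\<lambda>t. t *\<^sub>R x" and g = \<omega>])
           (use \<omega> in_S x t in \<open>auto intro!: derivative_eq_intros\<close>)
      have "((\<lambda>t. t *\<^sub>R \<omega> (t *\<^sub>R x)) has_vector_derivative F' x t) (at t)"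
        unfolding has_vector_derivative_def F'_def
        by (rule derivative_eq_intros * refl)+
           (auto simp: blinfun.scaleR_right scaleR_add_right mult.commute)
      then show "((\<lambda>t. t *\<^sub>R \<omega> (t *\<^sub>R x)) has_vector_derivative F' x t) (at t within {0..1})"
        by (rule has_vector_derivative_at_within)
    qed simp
    then show ?thesis by simp
  qed
  have "((\<lambda>x. integral (cbox 0 1) (F x)) has_derivative integral (cbox 0 1) (F' x)) (at x within S)"
    if x: "x \<in> S" for x
  proof (rule leibniz_rule)
    show "((\<lambda>x. F x t) has_derivative blinfun_apply (F' x t)) (at x within S)"
      if "x \<in> S" "t \<in> cbox 0 1" for x t
      using dF that by (auto intro: has_derivative_at_withinI)
    show "F x integrable_on cbox 0 1" if "x \<in> S" for x
      unfolding F_def using in_S[OF that]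
      by (intro integrable_continuous continuous_intros continuous_on_compose2[OF cont\<omega>]) auto
    show "continuous_on (S \<times> cbox 0 1) (\<lambda>(x, t). F' x t)"
      unfolding F'_def split_beta using in_S
      by (intro continuous_intros continuous_on_compose2[OF cont\<omega>] continuous_on_compose2[OF cont]) auto
  qed (use assms x in auto)
  then have "((\<lambda>x. integral (cbox 0 1) (F x)) has_derivative blinfun_apply (\<omega> x)) (at x)"
    if "x \<in> S" for x
    using that integral_unique[OF int[OF that]] at_within_open[OF that \<open>open S\<close>]
    by (metis box_real(2))
  then show thesis by (rule that)
qed

section \<open>The Hermitian inner product\<close>

lemma hinner_simps:
  "hinner (x + y) z = hinner x z + hinner y z" "hinner z (x + y) = hinner z x + hinner z y"
  "hinner (x - y) z = hinner x z - hinner y z" "hinner z (x - y) = hinner z x - hinner z y"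
  "hinner (c *s x) z = c * hinner x z" "hinner z (c *s x) = cnj c * hinner z x"
  by (simp_all add: hinner_def algebra_simps sum.distrib sum_subtractf sum_distrib_left)

lemma hinner_scaleR_left: "hinner (r *\<^sub>R x) z = r *\<^sub>R hinner x z"
  by (simp add: hinner_def scaleR_sum_right)

lemma cnj_hinner: "cnj (hinner x y) = hinner y x"
  by (simp add: hinner_def mult.commute)

lemma hinner_self: "hinner z z = of_real ((norm z)\<^sup>2)"
proof -
  have "(norm z)\<^sup>2 = (\<Sum>i\<in>UNIV. (norm (z $ i))\<^sup>2)"
    by (simp add: norm_vec_def L2_set_def sum_nonneg)
  then show ?thesis
    unfolding hinner_def by (simp only: of_real_sum complex_norm_square)
qed

lemma norm_eq_1_iff_hinner: "norm e = 1 \<longleftrightarrow> hinner e e = 1"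
  unfolding hinner_self of_real_eq_1_iff using norm_ge_zero[of e] by (auto simp: power2_eq_1_iff simp del: norm_ge_zero)

lemma Re_hinner: "Re (hinner x y) = x \<bullet> y"
  by (simp add: hinner_def inner_vec_def inner_complex_def)

section \<open>Lower bounds from the Schwarz lemma\<close>

text \<open>The Schwarz lemma is applied to \<open>G\<close> followed by the Moebius map that sends
  \<open>G 0\<close> to 0. Clearing the denominator leaves \<open>1 + norm z * norm (G 0)\<close> as
  the factor of \<open>norm (G z)\<close>, and this is at most 2.\<close>

lemma Schwarz_Pick_lower_bound:
  assumes "G holomorphic_on ball 0 1" and G1: "\<And>z. norm z < 1 \<Longrightarrow> norm (G z) < 1"
    and z: "norm z < 1"
  shows "norm (G 0) - norm z \<le> 2 * norm (G z)"
proof -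
  define x where "x = G 0"
  have x: "norm x < 1" using G1[of 0] by (simp add: x_def)
  have "norm ((Moebius_function 0 x \<circ> G) z) \<le> norm z"
  proof (rule Schwarz_Lemma(1))
    show "Moebius_function 0 x \<circ> G holomorphic_on ball 0 1"
      using assms x by (intro holomorphic_on_compose_gen[OF _ Moebius_function_holomorphic]) auto
  qed (use x G1 z Moebius_function_norm_lt_1 in \<open>auto simp: x_def Moebius_function_eq_zero\<close>)
  moreover have "norm (cnj x * G z) < 1"
    using mult_strict_mono'[of "norm x" 1 "norm (G z)" 1] x G1[OF z] by (simp add: norm_mult)
  then have "norm (1 - cnj x * G z) > 0" by auto
  ultimately have "norm (G z - x) \<le> norm z * norm (1 - cnj x * G z)"
    by (simp add: Moebius_function_def norm_divide divide_le_eq)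
  also have "\<dots> \<le> norm z * (1 + norm x * norm (G z))"
    using norm_triangle_ineq4[of 1 "cnj x * G z"] by (intro mult_left_mono) (auto simp: norm_mult)
  finally have "norm x - norm (G z) \<le> norm z + (norm z * norm x) * norm (G z)"
    using norm_triangle_ineq2[of x "G z"] by (simp add: norm_minus_commute algebra_simps)
  moreover have "norm z * norm x \<le> 1" using z x by (simp add: mult_le_one)
  then have "(norm z * norm x) * norm (G z) \<le> norm (G z)"
    by (intro mult_left_le_one_le) auto
  ultimately show ?thesis by (simp add: x_def)
qed

text \<open>On the disc of radius \<open>s\<close> the weight is at least \<open>k\<close>, so
  \<open>k * F\<close>, rescaled to the unit disc, is bounded by 1 and the Schwarz-Pick bound
  applies. For \<open>norm z \<ge> s\<close> the left-hand side is not positive.\<close>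

lemma weighted_bound_at_zero:
  fixes F :: "complex \<Rightarrow> complex"
  assumes holF: "F holomorphic_on ball 0 1" and p: "p > 0" and s: "0 < s" "s < 1"
    and bd: "\<And>z. norm z < 1 \<Longrightarrow> sqrt (1 - (norm z)\<^sup>2) ^ p * norm (F z) \<le> 1"
    and z: "norm z < 1"
  shows "norm (F 0) - norm z / (s * sqrt (1 - s\<^sup>2) ^ p) \<le> 2 * norm (F z)"
proof -
  define k where "k = sqrt (1 - s\<^sup>2) ^ p"
  have s2: "s\<^sup>2 < 1" using s by (simp add: power_less_one_iff)
  have k: "0 < k" "k \<le> 1" using s s2 by (auto simp: k_def power_le_one)
  show ?thesis
  proof (cases "norm z < s")
    case True
    define G where "G \<zeta> = of_real k * F (of_real s * \<zeta>)" for \<zeta>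
    have "norm (G 0) - norm (z / of_real s) \<le> 2 * norm (G (z / of_real s))"
    proof (rule Schwarz_Pick_lower_bound)
      have "F \<circ> (\<lambda>\<zeta>. of_real s * \<zeta>) holomorphic_on ball 0 1"
      proof (rule holomorphic_on_compose_gen[OF _ holF])
        show "(\<lambda>\<zeta> :: complex. of_real s * \<zeta>) ` ball 0 1 \<subseteq> ball 0 1"
          using s mult_strict_mono'[of s 1 "norm z" 1 for z :: complex]
          by (auto simp: norm_mult)
      qed (intro holomorphic_intros)
      then show "G holomorphic_on ball 0 1"
        by (auto simp: G_def[abs_def] o_def intro!: holomorphic_intros)
      show "norm (G \<zeta>) < 1" if "norm \<zeta> < 1" for \<zeta>
      \<comment> \<open>The bound has to be strict. Strictness comes from the weight, which exceeds
        \<open>k\<close> inside the disc of radius \<open>s\<close>, as soon as the value of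
        \<open>F\<close> is nonzero.\<close>
      proof (cases "F (of_real s * \<zeta>) = 0")
        case False
        have "s * norm \<zeta> < s" using that s by simp
        then have lt: "norm (of_real s * \<zeta>) < s" using s by (simp add: norm_mult)
        then have "(norm (of_real s * \<zeta>))\<^sup>2 < s\<^sup>2" by (intro power_strict_mono) auto
        then have "k < sqrt (1 - (norm (of_real s * \<zeta>))\<^sup>2) ^ p"
          unfolding k_def using s2 p by (intro power_strict_mono) auto
        then have "k * norm (F (of_real s * \<zeta>)) <
            sqrt (1 - (norm (of_real s * \<zeta>))\<^sup>2) ^ p * norm (F (of_real s * \<zeta>))"
          using False by (intro mult_strict_right_mono) auto
        also have "\<dots> \<le> 1" using lt s by (intro bd) auto
        finally show ?thesis using k by (simp add: G_def norm_mult)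
      qed (simp add: G_def)
      show "norm (z / of_real s) < 1" using True s by (simp add: norm_divide)
    qed
    then have "k * norm (F 0) - norm z / s \<le> k * (2 * norm (F z))"
      using k s by (simp add: G_def norm_mult norm_divide)
    then have "(k * norm (F 0) - norm z / s) / k \<le> 2 * norm (F z)"
      using k by (simp add: divide_le_eq mult.commute)
    then show ?thesis using k by (simp add: k_def[symmetric] diff_divide_distrib)
  next
    case False
    have "norm (F 0) \<le> 1" using bd[of 0] by simp
    moreover have "1 \<le> norm z / (s * k)"
      using False k s mult_mono[of s "norm z" k 1] by (simp add: le_divide_eq)
    ultimately have "norm (F 0) - norm z / (s * k) \<le> 0" by linarith
    then show ?thesis using norm_ge_zero[of "F z"] unfolding k_def[symmetric] by linarith
  qed
qed

section \<open>Moebius invariance and the weighted bound on the disc\<close>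

lemma norm_diff_one_sq:
  fixes a b :: complex
  shows "(norm (1 - cnj b * a))\<^sup>2 - (norm (a - b))\<^sup>2 = (1 - (norm a)\<^sup>2) * (1 - (norm b)\<^sup>2)"
  unfolding cmod_power2 by (simp add: power2_eq_square algebra_simps)

lemma one_minus_norm_moebius_sq:
  assumes "norm a < 1" "norm b < 1"
  shows "1 - (norm (Moebius_function 0 b a))\<^sup>2 =
    (1 - (norm a)\<^sup>2) * (1 - (norm b)\<^sup>2) / (norm (1 - cnj b * a))\<^sup>2"
proof -
  have "norm (cnj b * a) < 1"
    using assms mult_strict_mono'[of "norm b" 1 "norm a" 1] by (simp add: norm_mult)
  then have "1 - cnj b * a \<noteq> 0" by auto
  then have "(norm (1 - cnj b * a))\<^sup>2 \<noteq> 0" by simp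
  then show ?thesis
    using norm_diff_one_sq[of b a] by (simp add: Moebius_function_def norm_divide power_divide field_simps)
qed

text \<open>The hypothesis \<open>ab\<close> says that the pseudo-hyperbolic distance of
  \<open>a\<close> and \<open>b\<close> is at most \<rho>. A Moebius map carries \<open>b\<close> to
  the origin and \<open>a\<close> to a point \<zeta> with \<open>norm \<zeta> \<le> \<rho>\<close>,
  where the bound at the origin can be used.\<close>

lemma weighted_bound_disc:
  fixes F :: "complex \<Rightarrow> complex"
  assumes holF: "F holomorphic_on ball 0 1" and p: "p > 0" and s: "0 < s" "s < 1"
    and bd: "\<And>z. norm z < 1 \<Longrightarrow> sqrt (1 - (norm z)\<^sup>2) ^ p * norm (F z) \<le> 1"
    and a: "norm a < 1" and b: "norm b < 1" and \<rho>: "0 \<le> \<rho>" "\<rho> < 1"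
    and ab: "1 - \<rho>\<^sup>2 \<le> (1 - (norm a)\<^sup>2) * (1 - (norm b)\<^sup>2) / (norm (1 - cnj b * a))\<^sup>2"
  shows "sqrt (1 - \<rho>\<^sup>2) ^ p *
      (sqrt (1 - (norm b)\<^sup>2) ^ p * norm (F b) - \<rho> / (s * sqrt (1 - s\<^sup>2) ^ p))
    \<le> 2 * (sqrt (1 - (norm a)\<^sup>2) ^ p * norm (F a))" (is "?q * (?B - ?m) \<le> 2 * ?A")
proof -
  define \<psi> where "\<psi> = Moebius_function 0 (- b)"
  define \<zeta> where "\<zeta> = Moebius_function 0 b a"
  \<comment> \<open>The modulus of \<open>k z\<close> is the quotient of
    \<open>sqrt (1 - (norm (\<psi> z))\<^sup>2)\<close> by
    \<open>sqrt (1 - (norm z)\<^sup>2)\<close>, so \<open>H\<close> inherits the weighted bound of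
    \<open>F\<close>. As \<open>p\<close> is a natural number, \<open>k z ^ p\<close> is holomorphic
    without any choice of a branch.\<close>
  define k where "k z = of_real (sqrt (1 - (norm b)\<^sup>2)) / (1 + cnj b * z)" for z
  define H where "H z = k z ^ p * F (\<psi> z)" for z
  have \<zeta>: "norm \<zeta> < 1" unfolding \<zeta>_def by (rule Moebius_function_norm_lt_1[OF b a])
  have \<psi>\<zeta>: "\<psi> \<zeta> = a"
    unfolding \<psi>_def \<zeta>_def by (rule Moebius_function_compose) (use a b in auto)
  have "1 - \<rho>\<^sup>2 \<le> 1 - (norm \<zeta>)\<^sup>2"
    using ab one_minus_norm_moebius_sq[OF a b] by (simp add: \<zeta>_def)
  then have \<zeta>\<rho>: "norm \<zeta> \<le> \<rho>" and sq: "sqrt (1 - \<rho>\<^sup>2) \<le> sqrt (1 - (norm \<zeta>)\<^sup>2)"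
    using \<rho> by (auto intro: power2_le_imp_le)
  have nz: "1 + cnj b * z \<noteq> 0" if "norm z < 1" for z
  proof
    assume "1 + cnj b * z = 0"
    then have "norm (cnj b * z) = 1" by (metis add_eq_0_iff norm_minus_cancel norm_one)
    then show False
      using mult_strict_mono'[of "norm b" 1 "norm z" 1] b that by (simp add: norm_mult)
  qed
  have \<psi>1: "norm (\<psi> z) < 1" if "norm z < 1" for z
    unfolding \<psi>_def using that b by (intro Moebius_function_norm_lt_1) auto
  have k: "sqrt (1 - (norm z)\<^sup>2) * norm (k z) = sqrt (1 - (norm (\<psi> z))\<^sup>2)" if z: "norm z < 1" for z
  proof -
    have "1 - (norm (\<psi> z))\<^sup>2 = (1 - (norm z)\<^sup>2) * (1 - (norm b)\<^sup>2) / (norm (1 + cnj b * z))\<^sup>2"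
      unfolding \<psi>_def using one_minus_norm_moebius_sq[of z "- b"] z b by simp
    moreover have "1 - (norm b)\<^sup>2 \<ge> 0" using b by (simp add: power_le_one)
    ultimately show ?thesis
      by (simp add: k_def norm_divide real_sqrt_divide real_sqrt_mult)
  qed
  have H: "sqrt (1 - (norm z)\<^sup>2) ^ p * norm (H z) = sqrt (1 - (norm (\<psi> z))\<^sup>2) ^ p * norm (F (\<psi> z))"
    if "norm z < 1" for z
    unfolding k[OF that, symmetric] H_def by (simp add: norm_mult norm_power power_mult_distrib)
  have "norm (H 0) - norm \<zeta> / (s * sqrt (1 - s\<^sup>2) ^ p) \<le> 2 * norm (H \<zeta>)"
  proof (rule weighted_bound_at_zero[OF _ p s _ \<zeta>])
    have "F \<circ> \<psi> holomorphic_on ball 0 1"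
      using b \<psi>1 unfolding \<psi>_def
      by (intro holomorphic_on_compose_gen[OF Moebius_function_holomorphic holF]) auto
    then show "H holomorphic_on ball 0 1"
      unfolding H_def[abs_def] k_def[abs_def] o_def by (intro holomorphic_intros) (use nz in auto)
    show "sqrt (1 - (norm z)\<^sup>2) ^ p * norm (H z) \<le> 1" if "norm z < 1" for z
      using H[OF that] bd[OF \<psi>1[OF that]] by simp
  qed
  moreover have "\<psi> 0 = b" by (simp add: \<psi>_def Moebius_function_def)
  then have "norm (H 0) = ?B"
    using H[of 0] by simp
  moreover have "norm \<zeta> / (s * sqrt (1 - s\<^sup>2) ^ p) \<le> ?m"
    using \<zeta>\<rho> s by (intro divide_right_mono) (auto simp: power_le_one)
  ultimately have "?B - ?m \<le> 2 * norm (H \<zeta>)" by linarith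
  moreover have "?q \<ge> 0" using \<rho> by (simp add: power_le_one)
  ultimately have "?q * (?B - ?m) \<le> ?q * (2 * norm (H \<zeta>))"
    by (rule mult_left_mono)
  also have "\<dots> \<le> sqrt (1 - (norm \<zeta>)\<^sup>2) ^ p * (2 * norm (H \<zeta>))"
    using sq \<rho> by (intro mult_right_mono power_mono) (auto simp: power_le_one)
  also have "\<dots> = 2 * ?A"
    using H[OF \<zeta>] by (simp add: \<psi>\<zeta>)
  finally show ?thesis .
qed

text \<open>Scalar-valued counterpart of \<open>holomorphic_map_on\<close>. Additivity of
  \<open>L\<close> is part of \<open>has_derivative\<close>, so homogeneity over the complex numbers
  is all that complex linearity adds.\<close>

definition holomorphic_fun_on :: "(complex ^ 'n \<Rightarrow> complex) \<Rightarrow> (complex ^ 'n) set \<Rightarrow> bool"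
  where "holomorphic_fun_on F S \<longleftrightarrow>
    (\<forall>z\<in>S. \<exists>L. (F has_derivative L) (at z) \<and> (\<forall>c v. L (c *s v) = c * L v))"

section \<open>Restriction to complex lines in the ball\<close>

lemma unit_direction:
  fixes w u :: "complex ^ 'n"
  obtains e l where "norm e = 1" "u = w + l *s e"
proof (cases "u = w")
  case True
  have "hinner (axis undefined 1 :: complex ^ 'n) (axis undefined 1) = 1"
    by (simp add: hinner_def axis_def if_distrib cong: if_cong)
  then show thesis using True that[of "axis undefined 1" 0] by (simp add: norm_eq_1_iff_hinner)
next
  case False
  define N where "N = complex_of_real (norm (u - w))"
  have N: "N \<noteq> 0" using False by (simp add: N_def)
  define e where "e = inverse N *s (u - w)"
  have "hinner e e = 1"
    unfolding e_def hinner_simps(5,6) hinner_self[of "u - w"] using N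
    by (simp add: N_def power2_eq_square field_simps)
  then have "norm e = 1"
    by (simp only: norm_eq_1_iff_hinner)
  moreover have "u = w + N *s e" using N by (simp add: e_def vector_smult_assoc)
  ultimately show thesis by (rule that)
qed

text \<open>Here \<open>c\<close> is the point of the line through \<open>u\<close> and
  \<open>w\<close> that is closest to the origin. By orthogonality the line meets the ball in a disc
  with centre \<open>c\<close> and radius \<open>R\<close>, which the coordinate along
  \<open>e\<close> scales to the unit disc.\<close>

lemma complex_line_chart:
  fixes w u :: "complex ^ 'n"
  assumes w: "norm w < 1"
  obtains c e R b a where "hinner c e = 0" "norm e = 1" "0 < R" "R\<^sup>2 = 1 - (norm c)\<^sup>2"
    "w = c + (of_real R * b) *s e" "u = c + (of_real R * a) *s e"
proof -
  obtain e l where e: "norm e = 1" and l: "u = w + l *s e" by (rule unit_direction)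
  define \<alpha> where "\<alpha> = hinner w e"
  define c where "c = w - \<alpha> *s e"
  define R where "R = sqrt (1 - (norm c)\<^sup>2)"
  have ee: "hinner e e = 1" using e by (simp add: hinner_self)
  have ce: "hinner c e = 0" by (simp add: c_def hinner_simps ee) (simp add: \<alpha>_def)
  have "hinner c c = hinner w w - \<alpha> * cnj \<alpha>"
    by (simp add: c_def hinner_simps ee cnj_hinner[of w e, symmetric] algebra_simps) (simp add: \<alpha>_def)
  then have "of_real ((norm c)\<^sup>2) = (of_real ((norm w)\<^sup>2 - (norm \<alpha>)\<^sup>2) :: complex)"
    unfolding hinner_self by (simp only: of_real_diff complex_norm_square)
  then have "(norm c)\<^sup>2 = (norm w)\<^sup>2 - (norm \<alpha>)\<^sup>2" by (simp only: of_real_eq_iff)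
  moreover have "(norm w)\<^sup>2 < 1" using w by (simp add: power_less_one_iff)
  ultimately have "(norm c)\<^sup>2 < 1" by (smt (verit) zero_le_power2)
  then have R: "R > 0" "R\<^sup>2 = 1 - (norm c)\<^sup>2" by (auto simp: R_def)
  show thesis
    by (rule that[of c e R "\<alpha> / of_real R" "(\<alpha> + l) / of_real R", OF ce e R])
       (use R l in \<open>simp_all add: c_def vec_eq_iff distrib_right\<close>)
qed

lemma weighted_bound_ball:
  fixes F :: "complex ^ 'n \<Rightarrow> complex"
  assumes holF: "holomorphic_fun_on F unit_ball" and p: "p > 0" and s: "0 < s" "s < 1"
    and bd: "\<And>z. norm z < 1 \<Longrightarrow> sqrt (1 - (norm z)\<^sup>2) ^ p * norm (F z) \<le> 1"
    and u: "norm u < 1" and w: "norm w < 1" and \<rho>: "0 \<le> \<rho>" "\<rho> < 1"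
    and uw: "1 - \<rho>\<^sup>2 \<le> (1 - (norm u)\<^sup>2) * (1 - (norm w)\<^sup>2) / (norm (1 - hinner u w))\<^sup>2"
  shows "sqrt (1 - \<rho>\<^sup>2) ^ p *
      (sqrt (1 - (norm w)\<^sup>2) ^ p * norm (F w) - \<rho> / (s * sqrt (1 - s\<^sup>2) ^ p))
    \<le> 2 * (sqrt (1 - (norm u)\<^sup>2) ^ p * norm (F u))"
proof -
  obtain c e R b a where ce: "hinner c e = 0" "norm e = 1" and R: "0 < R" "R\<^sup>2 = 1 - (norm c)\<^sup>2"
    and wb: "w = c + (of_real R * b) *s e" and ua: "u = c + (of_real R * a) *s e"
    using complex_line_chart[OF w] by blast
  define P where "P \<eta> = c + (of_real R * \<eta>) *s e" for \<eta>
  \<comment> \<open>The factor \<open>R ^ p\<close> matches the weights: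
    \<open>1 - (norm (P \<eta>))\<^sup>2\<close> is \<open>R\<^sup>2\<close> times
    \<open>1 - (norm \<eta>)\<^sup>2\<close>.\<close>
  define G where "G \<eta> = of_real (R ^ p) * F (P \<eta>)" for \<eta>
  have ec: "hinner e c = 0" using ce(1) cnj_hinner[of c e] by simp
  have R': "of_real (R\<^sup>2) = (1 - hinner c c :: complex)"
    unfolding R(2) hinner_self by simp
  have ee: "hinner e e = 1" using ce(2) norm_eq_1_iff_hinner by blast
  \<comment> \<open>The diagonal case gives the weight along the line, the general case the
    denominator of the invariant quotient. The powers of \<open>R\<close> then cancel in that
    quotient.\<close>
  have hP: "1 - hinner (P x) (P y) = of_real (R\<^sup>2) * (1 - cnj y * x)" for x y
  proof -
    have "hinner (P x) (P y) = hinner c c + of_real (R\<^sup>2) * (cnj y * x)"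
      using ce(1) ec ee by (simp add: P_def hinner_simps power2_eq_square algebra_simps)
    then show ?thesis unfolding R' by (simp add: algebra_simps)
  qed
  have nP: "1 - (norm (P \<eta>))\<^sup>2 = R\<^sup>2 * (1 - (norm \<eta>)\<^sup>2)" for \<eta>
  proof -
    have "of_real (1 - (norm (P \<eta>))\<^sup>2) = (of_real (R\<^sup>2 * (1 - (norm \<eta>)\<^sup>2)) :: complex)"
      using hP[of \<eta> \<eta>] unfolding hinner_self of_real_diff of_real_mult[of "R\<^sup>2"]
      by (simp only: complex_norm_square of_real_1 mult.commute)
    then show ?thesis by (simp only: of_real_eq_iff)
  qed
  have in_ball: "norm (P \<eta>) < 1 \<longleftrightarrow> norm \<eta> < 1" for \<eta>
  proof -
    have "norm (P \<eta>) < 1 \<longleftrightarrow> 0 < 1 - (norm (P \<eta>))\<^sup>2" by (simp add: power_less_one_iff)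
    also have "\<dots> \<longleftrightarrow> norm \<eta> < 1" using R(1) by (simp add: nP zero_less_mult_iff power_less_one_iff)
    finally show ?thesis .
  qed
  have wG: "sqrt (1 - (norm \<eta>)\<^sup>2) ^ p * norm (G \<eta>) = sqrt (1 - (norm (P \<eta>))\<^sup>2) ^ p * norm (F (P \<eta>))" for \<eta>
    using R(1) by (simp add: nP G_def norm_mult norm_power real_sqrt_mult power_mult_distrib)
  have b: "norm b < 1" and a: "norm a < 1"
    using u w in_ball[of a] in_ball[of b] by (auto simp: P_def ua wb)
  have "sqrt (1 - \<rho>\<^sup>2) ^ p *
      (sqrt (1 - (norm b)\<^sup>2) ^ p * norm (G b) - \<rho> / (s * sqrt (1 - s\<^sup>2) ^ p))
    \<le> 2 * (sqrt (1 - (norm a)\<^sup>2) ^ p * norm (G a))"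
  proof (rule weighted_bound_disc[OF _ p s _ a b \<rho>])
    show "G holomorphic_on ball 0 1"
    proof (rule holomorphic_onI)
      fix \<eta> :: complex assume "\<eta> \<in> ball 0 1"
      then have "P \<eta> \<in> unit_ball" using in_ball[of \<eta>] by simp
      then obtain L where L: "(F has_derivative L) (at (P \<eta>))" "\<And>c v. L (c *s v) = c * L v"
        using holF unfolding holomorphic_fun_on_def by blast
      have bl: "bounded_linear (\<lambda>h. (of_real R * h) *s e)"
      proof -
        have "bounded_linear (\<lambda>h. h *s e)"
          by (rule bounded_linear_intro[where K = "norm e"])
             (auto simp: vec_eq_iff algebra_simps norm_mult norm_vec_def L2_set_def
                power_mult_distrib sum_distrib_left[symmetric] real_sqrt_mult)
        then show ?thesis by (intro bounded_linear_compose[OF _ bounded_linear_mult_right, unfolded o_def])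
      qed
      have "(P has_derivative (\<lambda>h. (of_real R * h) *s e)) (at \<eta>)"
        unfolding P_def using bounded_linear.has_derivative[OF bl has_derivative_ident]
        by (auto intro!: derivative_eq_intros)
      from has_derivative_compose[OF this L(1)]
      have "(G has_derivative (\<lambda>h. of_real (R ^ p) * L ((of_real R * h) *s e))) (at \<eta>)"
        unfolding G_def[abs_def] by (auto intro!: derivative_eq_intros)
      then have "(G has_field_derivative of_real (R ^ p) * (of_real R * L e)) (at \<eta>)"
        unfolding has_field_derivative_def L(2) by (rule has_derivative_eq_rhs) (simp add: fun_eq_iff)
      then show "G field_differentiable at \<eta> within ball 0 1"
        using field_differentiable_def field_differentiable_at_within by blast
    qed
    show "sqrt (1 - (norm z)\<^sup>2) ^ p * norm (G z) \<le> 1" if "norm z < 1" for z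
      unfolding wG using that in_ball by (intro bd) auto
    have "(1 - (norm u)\<^sup>2) * (1 - (norm w)\<^sup>2) / (norm (1 - hinner u w))\<^sup>2 =
        (1 - (norm a)\<^sup>2) * (1 - (norm b)\<^sup>2) / (norm (1 - cnj b * a))\<^sup>2"
      using R(1) hP[of a b] nP[of a] nP[of b] unfolding P_def ua[symmetric] wb[symmetric]
      by (simp add: norm_mult power_mult_distrib power2_eq_square)
    then show "1 - \<rho>\<^sup>2 \<le> (1 - (norm a)\<^sup>2) * (1 - (norm b)\<^sup>2) / (norm (1 - cnj b * a))\<^sup>2"
      using uw by simp
  qed
  then show ?thesis
    unfolding wG by (simp add: P_def ua wb)
qed

section \<open>A lower bound for the Bergman distance\<close>

lemma bergman_matrix_mult:
  "bergman_matrix z *v v =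
    (1 / of_real (1 - (norm z)\<^sup>2)) *s v + (hinner v z / of_real ((1 - (norm z)\<^sup>2)\<^sup>2)) *s z"
proof -
  let ?s = "complex_of_real (1 - (norm z)\<^sup>2)"
  have "(\<Sum>j\<in>UNIV. (?s * (if i = j then 1 else 0) + z $ i * cnj (z $ j)) / ?s\<^sup>2 * v $ j) =
      1 / ?s * v $ i + hinner v z / ?s\<^sup>2 * z $ i" for i
  proof -
    have "(\<Sum>j\<in>UNIV. (?s * (if i = j then 1 else 0) + z $ i * cnj (z $ j)) / ?s\<^sup>2 * v $ j) =
        (\<Sum>j\<in>UNIV. (if i = j then ?s / ?s\<^sup>2 * v $ j else 0) + z $ i / ?s\<^sup>2 * (v $ j * cnj (z $ j)))"
      by (intro sum.cong refl) (simp add: add_divide_distrib ring_distribs)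
    also have "\<dots> = ?s / ?s\<^sup>2 * v $ i + z $ i / ?s\<^sup>2 * hinner v z"
      by (simp add: sum.distrib sum_distrib_left[symmetric] sum_divide_distrib[symmetric] hinner_def)
    finally show ?thesis by (simp add: power2_eq_square)
  qed
  then show ?thesis
    by (simp add: vec_eq_iff matrix_vector_mult_def bergman_matrix_def)
qed

lemma bergman_form:
  "Re (hinner (bergman_matrix z *v v) v) =
    (norm v)\<^sup>2 / (1 - (norm z)\<^sup>2) + (norm (hinner v z))\<^sup>2 / (1 - (norm z)\<^sup>2)\<^sup>2"
proof -
  have "hinner v z * hinner z v = of_real ((norm (hinner v z))\<^sup>2)"
    by (simp only: complex_norm_square cnj_hinner)
  then have "hinner (bergman_matrix z *v v) v =
      of_real ((norm v)\<^sup>2 / (1 - (norm z)\<^sup>2) + (norm (hinner v z))\<^sup>2 / (1 - (norm z)\<^sup>2)\<^sup>2)"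
    unfolding bergman_matrix_mult hinner_simps hinner_self by simp
  then show ?thesis by simp
qed

text \<open>Cauchy-Schwarz for the Bergman form, where the functional \<open>v \<bullet> a\<close>
  is represented by a vector \<open>b\<close>. The factor in front of the form is the squared
  Bergman length of \<open>b\<close>, that is, of \<open>a\<close> in the dual metric.\<close>

lemma bergman_form_Cauchy_Schwarz:
  assumes z: "norm z < 1"
  shows "0 \<le> (1 - (norm z)\<^sup>2) * ((norm a)\<^sup>2 - (norm (hinner a z))\<^sup>2)" (is "0 \<le> ?m")
    and "(v \<bullet> a)\<^sup>2 \<le> (1 - (norm z)\<^sup>2) * ((norm a)\<^sup>2 - (norm (hinner a z))\<^sup>2) *
      Re (hinner (bergman_matrix z *v v) v)"
proof -
  define k where "k = 1 - (norm z)\<^sup>2"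
  have k: "k > 0" using z by (simp add: k_def power_less_one_iff)
  \<comment> \<open>\<open>X\<close> embeds the tangent space at \<open>z\<close> isometrically into
    a product of inner product spaces: the Bergman form of \<open>v\<close> is
    \<open>X v \<bullet> X v\<close>.\<close>
  define X where "X x = ((1 / sqrt k) *\<^sub>R x, hinner x z / of_real k)" for x
  \<comment> \<open>This is the inverse of the Bergman matrix applied to \<open>a\<close>, whence
    \<open>X x \<bullet> X b = x \<bullet> a\<close> for all \<open>x\<close>.\<close>
  define b where "b = of_real k *s (a - hinner a z *s z)"
  have zz: "hinner z z = of_real (1 - k)" by (simp add: hinner_self k_def)
  have XX: "X x \<bullet> X y = Re (hinner x y / of_real k + hinner x z * cnj (hinner y z) / of_real (k\<^sup>2))" for x y
  proof -
    have "X x \<bullet> X y = (x \<bullet> y) / k + (hinner x z \<bullet> hinner y z) / k\<^sup>2"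
      using k by (simp add: X_def inner_complex_def power2_eq_square field_simps)
    then show ?thesis
      by (simp add: Re_hinner[symmetric] inner_complex_def Re_divide_of_real flip: of_real_power)
  qed
  have bz: "hinner b z = of_real (k\<^sup>2) * hinner a z"
    by (simp add: b_def hinner_simps zz power2_eq_square algebra_simps)
  have Xb: "X x \<bullet> X b = x \<bullet> a" for x
  proof -
    have "hinner x b / of_real k + hinner x z * cnj (hinner b z) / of_real (k\<^sup>2) = hinner x a"
      using k unfolding bz by (simp add: b_def hinner_simps diff_divide_distrib)
    then show ?thesis unfolding XX by (simp add: Re_hinner)
  qed
  have "hinner b a = of_real ?m"
  proof -
    have "hinner a z * hinner z a = of_real ((norm (hinner a z))\<^sup>2)"
      by (simp only: complex_norm_square cnj_hinner)
    moreover have "hinner b a = of_real k * (hinner a a - hinner a z * hinner z a)"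
      by (simp add: b_def hinner_simps algebra_simps)
    ultimately show ?thesis by (simp add: hinner_self k_def)
  qed
  then have bb: "X b \<bullet> X b = ?m"
    unfolding Xb Re_hinner[symmetric] by simp
  show "0 \<le> ?m" unfolding bb[symmetric] by simp
  have "X v \<bullet> X v = Re (hinner (bergman_matrix z *v v) v)"
    unfolding XX bergman_form complex_norm_square[symmetric] hinner_self k_def[symmetric] by simp
  then show "(v \<bullet> a)\<^sup>2 \<le> ?m * Re (hinner (bergman_matrix z *v v) v)"
    using Cauchy_Schwarz_ineq[of "X v" "X b"] unfolding bb unfolding Xb by (simp only: mult.commute)
qed

text \<open>Nonnegativity of the dual squared length of \<open>a\<close> already contains this
  estimate.\<close>

lemma norm_hinner_le:
  assumes "norm z < 1"
  shows "norm (hinner a z) \<le> norm a"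
proof -
  have "1 - (norm z)\<^sup>2 > 0" using assms by (simp add: power_less_one_iff)
  then have "(norm (hinner a z))\<^sup>2 \<le> (norm a)\<^sup>2"
    using bergman_form_Cauchy_Schwarz(1)[OF assms, of a] by (simp add: zero_le_mult_iff)
  then show ?thesis by (rule power2_le_imp_le) simp
qed

text \<open>The closed form of the hyperbolic cosine of the Bergman distance: its inverse square is
  one minus the squared modulus of the involution \<phi> of the ball interchanging 0 and
  \<open>w\<close>, taken at \<open>z\<close>. The estimate derived from it is that its arcosh is at
  most the distance.\<close>

definition cosh_bergman :: "complex ^ 'n \<Rightarrow> complex ^ 'n \<Rightarrow> real"
  where "cosh_bergman w z = norm (1 - hinner z w) / sqrt ((1 - (norm z)\<^sup>2) * (1 - (norm w)\<^sup>2))"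

text \<open>
  With \<open>a = z / (1 - |z|\<^sup>2) - w / (1 - \<langle>w, z\<rangle>)\<close> the derivative of \<open>ln (cosh_bergman w)\<close> at \<open>z\<close> in
  the direction \<open>v\<close> is \<open>v \<bullet> a\<close>, and the squared length of \<open>a\<close> in the dual Bergman metric is
  \<open>1 - 1 / (cosh_bergman w z)\<^sup>2\<close>.
\<close>

lemma
  assumes z: "norm z < 1" and w: "norm w < 1"
  defines "a \<equiv> (1 / of_real (1 - (norm z)\<^sup>2)) *s z - (1 / (1 - hinner w z)) *s w"
  shows cosh_bergman_ge_1: "cosh_bergman w z \<ge> 1"
    and log_derivative_cosh_bergman_bound: "(v \<bullet> a)\<^sup>2 \<le> (1 - 1 / (cosh_bergman w z)\<^sup>2) *
      Re (hinner (bergman_matrix z *v v) v)"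
proof -
  define k where "k = 1 - (norm z)\<^sup>2"
  define l where "l = 1 - (norm w)\<^sup>2"
  have kl: "k > 0" "l > 0" using z w by (simp_all add: k_def l_def power_less_one_iff)
  define D where "D = 1 - hinner w z"
  have "norm (hinner w z) < 1" using norm_hinner_le[OF z, of w] w by simp
  then have D: "D \<noteq> 0" by (auto simp: D_def)
  have D': "1 - hinner z w = cnj D" by (simp add: D_def cnj_hinner)
  have C: "(cosh_bergman w z)\<^sup>2 = (norm D)\<^sup>2 / (k * l)"
    unfolding cosh_bergman_def D' using kl by (simp add: power_divide k_def[symmetric] l_def[symmetric])
  have C0: "cosh_bergman w z > 0"
    unfolding cosh_bergman_def D' using kl D by (simp add: k_def[symmetric] l_def[symmetric])
  have zz: "hinner z z = 1 - of_real k" and ww: "hinner w w = 1 - of_real l"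
    and wz: "hinner w z = 1 - D" and zw: "hinner z w = 1 - cnj D"
    by (simp_all add: hinner_self k_def l_def D_def cnj_hinner)
  \<comment> \<open>Naming the reciprocals turns the rational identities below into polynomial ones
    modulo the relations \<open>xy\<close>.\<close>
  define x where "x = 1 / complex_of_real k"
  define y where "y = 1 / D"
  have xy: "x * of_real k = 1" "y * D = 1" "cnj y * cnj D = 1" "cnj x = x"
    using kl D by (simp_all add: x_def y_def)
  have aa: "a = x *s z - y *s w" by (simp add: a_def k_def D_def x_def y_def)
  have az: "hinner a z = x - y"
    unfolding aa hinner_simps zz wz using xy by algebra
  have "hinner a a - hinner a z * cnj (hinner a z) = x - of_real l * (y * cnj y)"
    unfolding az unfolding aa hinner_simps zz wz zw ww complex_cnj_diff xy(4) using xy(1-3) by algebra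
  also have "\<dots> = 1 / of_real k - of_real l / (D * cnj D)"
    by (simp add: x_def y_def)
  finally have "hinner a a - hinner a z * cnj (hinner a z) = 1 / of_real k - of_real l / (D * cnj D)" .
  then have "of_real ((norm a)\<^sup>2 - (norm (hinner a z))\<^sup>2) = (of_real (1 / k - l / (norm D)\<^sup>2) :: complex)"
    unfolding hinner_self of_real_diff of_real_divide by (simp only: complex_norm_square of_real_1)
  then have na: "(norm a)\<^sup>2 - (norm (hinner a z))\<^sup>2 = 1 / k - l / (norm D)\<^sup>2"
    by (simp only: of_real_eq_iff)
  have m: "k * ((norm a)\<^sup>2 - (norm (hinner a z))\<^sup>2) = 1 - 1 / (cosh_bergman w z)\<^sup>2"
    unfolding C na using kl D by (simp add: right_diff_distrib)
  show "(v \<bullet> a)\<^sup>2 \<le> (1 - 1 / (cosh_bergman w z)\<^sup>2) * Re (hinner (bergman_matrix z *v v) v)"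
    using bergman_form_Cauchy_Schwarz(2)[OF z, of v a] unfolding k_def[symmetric] m .
  have "0 \<le> 1 - 1 / (cosh_bergman w z)\<^sup>2"
    using bergman_form_Cauchy_Schwarz(1)[OF z, of a] unfolding k_def[symmetric] m .
  then have "1 \<le> (cosh_bergman w z)\<^sup>2" using C0 by (simp add: divide_le_eq)
  then show "cosh_bergman w z \<ge> 1" using C0 power2_le_imp_le[of 1 "cosh_bergman w z"] by simp
qed

section \<open>The logarithm of \<open>cosh_bergman\<close> along a curve\<close>

lemma has_real_derivative_inner_self:
  assumes "(f has_vector_derivative f') (at t)"
  shows "((\<lambda>t. f t \<bullet> f t) has_real_derivative 2 * (f t \<bullet> f')) (at t)"
  using has_derivative_inner[OF assms[unfolded has_vector_derivative_def] assms[unfolded has_vector_derivative_def]]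
  by (rule has_derivative_imp_has_field_derivative) (simp add: inner_commute)

lemma has_real_derivative_half_ln:
  assumes "(f has_real_derivative 2 * f') (at t)" "f t > 0"
  shows "((\<lambda>t. ln (f t) / 2) has_real_derivative f' / f t) (at t)"
  using assms by (auto intro!: derivative_eq_intros)

lemma Re_divide_inner: "Re (x / y) = (y \<bullet> x) / (y \<bullet> y)"
  by (simp add: Re_divide inner_complex_def power2_eq_square mult.commute)

text \<open>Splitting the logarithm and writing norms as real inner products leaves terms that can
  be differentiated one by one along a curve.\<close>

lemma ln_cosh_bergman:
  assumes z: "norm z < 1" and w: "norm w < 1"
  shows "ln (cosh_bergman w z) =
    ln ((1 - hinner z w) \<bullet> (1 - hinner z w)) / 2 - ln (1 - z \<bullet> z) / 2 - ln (1 - w \<bullet> w) / 2"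
proof -
  have nz: "hinner z w \<noteq> 1"
    using norm_hinner_le[OF w, of z] z by auto
  then have f: "(1 - hinner z w) \<bullet> (1 - hinner z w) > 0" by simp
  have pos: "1 - x \<bullet> x > 0" if "norm x < 1" for x :: "complex ^ 'n"
    using that by (simp add: power2_norm_eq_inner[symmetric] power_less_one_iff)
  show ?thesis
    unfolding cosh_bergman_def power2_norm_eq_inner norm_eq_sqrt_inner[of "1 - hinner z w"]
    using f nz pos[OF z] pos[OF w] by (simp add: ln_div ln_mult ln_sqrt real_sqrt_mult del: inner_gt_zero_iff)
qed

lemma has_real_derivative_ln_cosh_bergman:
  fixes \<gamma> :: "real \<Rightarrow> complex ^ 'n"
  assumes z: "norm (\<gamma> t) < 1" and w: "norm w < 1" and \<gamma>: "(\<gamma> has_vector_derivative v) (at t)"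
  shows "((\<lambda>t. ln (cosh_bergman w (\<gamma> t))) has_real_derivative
    v \<bullet> ((1 / of_real (1 - (norm (\<gamma> t))\<^sup>2)) *s \<gamma> t - (1 / (1 - hinner w (\<gamma> t))) *s w)) (at t)"
  (is "(_ has_real_derivative ?d) _")
proof -
  let ?f = "\<lambda>t. 1 - hinner (\<gamma> t) w"
  let ?g = "\<lambda>t. ln (?f t \<bullet> ?f t) / 2 - ln (1 - \<gamma> t \<bullet> \<gamma> t) / 2 - ln (1 - w \<bullet> w) / 2"
  have "bounded_linear (\<lambda>x. hinner x w)"
    using norm_hinner_le[OF w]
    by (intro bounded_linear_intro[where K = 1])
      (auto simp: hinner_simps hinner_scaleR_left)
  from bounded_linear.has_vector_derivative[OF this \<gamma>]
  have f: "(?f has_vector_derivative - hinner v w) (at t)"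
    by (auto intro!: derivative_eq_intros)
  note ff = has_real_derivative_inner_self[OF f]
  note gg = has_real_derivative_inner_self[OF \<gamma>]
  have nz: "1 - hinner x w \<noteq> 0" if "norm x < 1" for x
    using norm_hinner_le[OF w, of x] that by auto
  have pos: "1 - x \<bullet> x > 0" if "norm x < 1" for x :: "complex ^ 'n"
    using that by (simp add: power2_norm_eq_inner[symmetric] power_less_one_iff)
  have "(?g has_real_derivative (?f t \<bullet> - hinner v w) / (?f t \<bullet> ?f t)
      - - (\<gamma> t \<bullet> v) / (1 - \<gamma> t \<bullet> \<gamma> t)) (at t)"
  proof -
    have A: "((\<lambda>t. ln (?f t \<bullet> ?f t) / 2) has_real_derivative (?f t \<bullet> - hinner v w) / (?f t \<bullet> ?f t)) (at t)"
      using has_real_derivative_half_ln[OF ff] nz[OF z] by simp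
    have "((\<lambda>t. 1 - \<gamma> t \<bullet> \<gamma> t) has_real_derivative 2 * - (\<gamma> t \<bullet> v)) (at t)"
      using DERIV_diff[OF DERIV_const gg] by simp
    from DERIV_diff[OF A has_real_derivative_half_ln[OF this pos[OF z]]]
    have "((\<lambda>t. ln (?f t \<bullet> ?f t) / 2 - ln (1 - \<gamma> t \<bullet> \<gamma> t) / 2) has_real_derivative
      (?f t \<bullet> - hinner v w) / (?f t \<bullet> ?f t) - - (\<gamma> t \<bullet> v) / (1 - \<gamma> t \<bullet> \<gamma> t)) (at t)" .
    from DERIV_diff[OF this DERIV_const] show ?thesis by simp
  qed
  moreover have "(?f t \<bullet> - hinner v w) / (?f t \<bullet> ?f t) - - (\<gamma> t \<bullet> v) / (1 - \<gamma> t \<bullet> \<gamma> t) = ?d"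
  proof -
    have "cnj (1 - hinner w (\<gamma> t)) = ?f t" by (simp add: cnj_hinner)
    then have "?d = Re (hinner v (\<gamma> t) / of_real (1 - (norm (\<gamma> t))\<^sup>2) - hinner v w / ?f t)"
      unfolding Re_hinner[symmetric] by (simp add: hinner_simps cnj_hinner)
    also have "\<dots> = (v \<bullet> \<gamma> t) / (1 - (norm (\<gamma> t))\<^sup>2) - (?f t \<bullet> hinner v w) / (?f t \<bullet> ?f t)"
      unfolding minus_complex.sel Re_divide_of_real Re_hinner
        Re_divide_inner[of "hinner v w"] ..
    finally show ?thesis
      by (simp add: power2_norm_eq_inner inner_commute[of v])
  qed
  ultimately have "(?g has_real_derivative ?d) (at t)" by (simp only:)
  \<comment> \<open>The split formula is available only inside the ball, where the curve is known to
    be just at time \<open>t\<close>; continuity extends this to nearby times.\<close>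
  moreover have "\<forall>\<^sub>F s in nhds t. ln (cosh_bergman w (\<gamma> s)) = ?g s"
  proof -
    have "isCont \<gamma> t" using \<gamma> by (rule has_vector_derivative_continuous)
    then have "\<forall>\<^sub>F s in nhds t. \<gamma> s \<in> ball 0 1"
      unfolding isCont_def tendsto_at_iff_tendsto_nhds
      by (rule topological_tendstoD[OF _ open_ball]) (use z in simp)
    then show ?thesis
    proof eventually_elim
      case (elim s)
      then have "norm (\<gamma> s) < 1" by simp
      then show ?case
        using ln_cosh_bergman[of "\<gamma> s" w] w by simp
    qed
  qed
  ultimately show ?thesis
    by (subst DERIV_cong_ev[OF refl _ refl]) auto
qed

section \<open>Calculus along piecewise smooth curves\<close>

lemma piecewise_smooth_curve_piece:
  fixes \<gamma> :: "real \<Rightarrow> 'a::real_normed_vector"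
  assumes "a < b" and \<gamma>': "continuous_on {a..b} \<gamma>'"
    and d: "\<And>t. t \<in> {a..b} \<Longrightarrow> (\<gamma> has_vector_derivative \<gamma>' t) (at t within {a..b})"
  shows "t \<in> {a<..<b} \<Longrightarrow> (\<gamma> has_vector_derivative \<gamma>' t) (at t)"
    and "t \<in> {a<..<b} \<Longrightarrow> vector_derivative \<gamma> (at t) = \<gamma>' t"
    and "continuous_on {a..b} \<gamma>"
    and "continuous_on (S \<times> UNIV) (\<lambda>(x, v). G x v) \<Longrightarrow> \<gamma> ` {a..b} \<subseteq> S \<Longrightarrow>
      (\<lambda>t. G (\<gamma> t) (vector_derivative \<gamma> (at t)) :: real) integrable_on {a..b}"
proof -
  show *: "(\<gamma> has_vector_derivative \<gamma>' t) (at t)" if "t \<in> {a<..<b}" for t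
    using d[of t] that at_within_Icc_at[of a t b] by simp
  then show vd: "vector_derivative \<gamma> (at t) = \<gamma>' t" if "t \<in> {a<..<b}" for t
    using that by (simp add: vector_derivative_at)
  show c: "continuous_on {a..b} \<gamma>"
    unfolding continuous_on_eq_continuous_within by (blast intro: d has_vector_derivative_continuous)
  assume G: "continuous_on (S \<times> UNIV) (\<lambda>(x, v). G x v)" and im: "\<gamma> ` {a..b} \<subseteq> S"
  have "continuous_on {a..b} (\<lambda>t. (\<lambda>(x, v). G x v) (\<gamma> t, \<gamma>' t))"
    by (rule continuous_on_compose2[OF G]) (use c \<gamma>' im in \<open>auto intro!: continuous_intros\<close>)
  then have "(\<lambda>t. G (\<gamma> t) (\<gamma>' t)) integrable_on {a..b}"
    by (intro integrable_continuous_real) simp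
  then show "(\<lambda>t. G (\<gamma> t) (vector_derivative \<gamma> (at t))) integrable_on {a..b}"
  \<comment> \<open>At the two endpoints of the piece \<open>vector_derivative\<close> may differ
    from the one-sided derivative, so the integrands are compared away from them.\<close>
  proof (rule integrable_spike_finite[of "{a, b}", rotated 2])
    show "G (\<gamma> t) (vector_derivative \<gamma> (at t)) = G (\<gamma> t) (\<gamma>' t)" if "t \<in> {a..b} - {a, b}" for t
    proof -
      have "t \<in> {a<..<b}" using that by auto
      then show ?thesis using vd by simp
    qed
  qed simp
qed

text \<open>What the length estimate needs from a curve. The set \<open>S\<close> allows integrands
  \<open>G\<close> that are continuous only where the curve runs, such as the Bergman speed on the
  ball.\<close>

lemma piecewise_smooth_curveE:
  fixes \<gamma> :: "real \<Rightarrow> 'a::real_normed_vector"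
  assumes "piecewise_smooth_curve \<gamma>"
  obtains P where "finite P"
    "\<And>t. t \<in> {0..1} - P \<Longrightarrow> (\<gamma> has_vector_derivative vector_derivative \<gamma> (at t)) (at t)"
    "continuous_on {0..1} \<gamma>"
    "\<And>(G :: 'a \<Rightarrow> 'a \<Rightarrow> real) S. continuous_on (S \<times> UNIV) (\<lambda>(x, v). G x v) \<Longrightarrow> \<gamma> ` {0..1} \<subseteq> S \<Longrightarrow>
      (\<lambda>t. G (\<gamma> t) (vector_derivative \<gamma> (at t))) integrable_on {0..1}"
proof -
  from assms obtain P where P: "finite P" "{0, 1} \<subseteq> P" "P \<subseteq> {0..1}" and
    H: "\<forall>a\<in>P. \<forall>b\<in>P. a < b \<and> {a<..<b} \<inter> P = {} \<longrightarrow> (\<exists>\<gamma>'. continuous_on {a..b} \<gamma>' \<and>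
          (\<forall>t\<in>{a..b}. (\<gamma> has_vector_derivative \<gamma>' t) (at t within {a..b})))"
    unfolding piecewise_smooth_curve_def by (elim exE conjE)
  have piece: "\<exists>\<gamma>'. continuous_on {a..b} \<gamma>' \<and>
      (\<forall>t\<in>{a..b}. (\<gamma> has_vector_derivative \<gamma>' t) (at t within {a..b}))"
    if "a \<in> P" "b \<in> P" "a < b" "{a<..<b} \<inter> P = {}" for a b
    using H[rule_format, OF that(1,2)] that(3,4) by simp
  have pred: "\<exists>a\<in>P. a < t \<and> {a<..<t} \<inter> P = {}" if "0 < t" for t
  proof -
    let ?A = "{x \<in> P. x < t}"
    have A: "finite ?A" "?A \<noteq> {}" using P that by auto
    have "x \<le> Max ?A" if "x \<in> P" "x < t" for x
      using Max_ge[OF A(1), of x] that by simp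
    then have "{Max ?A<..<t} \<inter> P = {}" by (auto simp: leD)
    then show ?thesis using Max_in[OF A] by blast
  qed
  have succ: "\<exists>b\<in>P. t < b \<and> {t<..<b} \<inter> P = {}" if "t < 1" for t
  proof -
    let ?A = "{x \<in> P. t < x}"
    have A: "finite ?A" "?A \<noteq> {}" using P that by auto
    have "Min ?A \<le> x" if "x \<in> P" "t < x" for x
      using Min_le[OF A(1), of x] that by simp
    then have "{t<..<Min ?A} \<inter> P = {}" by (auto simp: leD)
    then show ?thesis using Min_in[OF A] by blast
  qed
  have deriv: "(\<gamma> has_vector_derivative vector_derivative \<gamma> (at t)) (at t)" if t: "t \<in> {0..1} - P" for t
  proof -
    have "0 < t" "t < 1" using t P(2) by (auto simp: less_le)
    then obtain a b where ab: "a \<in> P" "a < t" "{a<..<t} \<inter> P = {}" "b \<in> P" "t < b" "{t<..<b} \<inter> P = {}"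
      using pred succ by metis
    have "{a<..<b} = {a<..<t} \<union> {t} \<union> {t<..<b}" using ab by auto
    then have "{a<..<b} \<inter> P = {}" using ab t by blast
    then obtain \<gamma>' where g: "continuous_on {a..b} \<gamma>'"
        "\<And>t. t \<in> {a..b} \<Longrightarrow> (\<gamma> has_vector_derivative \<gamma>' t) (at t within {a..b})"
      using piece[OF ab(1,4)] ab(2,5) by (meson less_trans)
    show ?thesis
      using piecewise_smooth_curve_piece(1,2)[OF _ g, of t] ab by simp
  qed
  \<comment> \<open>The pieces are glued from left to right, by induction on the number of partition
    points below \<open>p\<close>; the case \<open>p = 1\<close> is the whole interval.\<close>
  have step: "continuous_on {0..p} \<gamma> \<and>
      (\<forall>(G :: 'a \<Rightarrow> 'a \<Rightarrow> real) S. continuous_on (S \<times> UNIV) (\<lambda>(x, v). G x v) \<longrightarrow> \<gamma> ` {0..1} \<subseteq> S \<longrightarrow>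
        (\<lambda>t. G (\<gamma> t) (vector_derivative \<gamma> (at t))) integrable_on {0..p})" if "p \<in> P" for p
    using that
  proof (induction "card {x \<in> P. x < p}" arbitrary: p rule: less_induct)
    case less
    have p: "0 \<le> p" "p \<le> 1" using less.prems P by auto
    show ?case
    proof (cases "p = 0")
      case False
      then obtain a where a: "a \<in> P" "a < p" "{a<..<p} \<inter> P = {}" using pred[of p] p by auto
      obtain \<gamma>' where g: "continuous_on {a..p} \<gamma>'"
          "\<And>t. t \<in> {a..p} \<Longrightarrow> (\<gamma> has_vector_derivative \<gamma>' t) (at t within {a..p})"
        using piece[OF a(1) less.prems a(2,3)] by blast
      have "card {x \<in> P. x < a} < card {x \<in> P. x < p}"
        using P(1) a by (intro psubset_card_mono) auto
      note IH = less.hyps[OF this a(1)]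
      have a0: "0 \<le> a" using a P by auto
      have un: "{0..p} = {0..a} \<union> {a..p}" using a0 a by auto
      have "continuous_on {0..p} \<gamma>"
        unfolding un using IH piecewise_smooth_curve_piece(3)[OF a(2) g]
        by (intro continuous_on_closed_Un) auto
      moreover have "(\<lambda>t. G (\<gamma> t) (vector_derivative \<gamma> (at t))) integrable_on {0..p}"
        if G: "continuous_on (S \<times> UNIV) (\<lambda>(x, v). G x v)" and S: "\<gamma> ` {0..1} \<subseteq> S"
        for G :: "'a \<Rightarrow> 'a \<Rightarrow> real" and S
      proof (rule Henstock_Kurzweil_Integration.integrable_combine)
        show "(\<lambda>t. G (\<gamma> t) (vector_derivative \<gamma> (at t))) integrable_on {0..a}"
          using IH G S by blast
        have "\<gamma> ` {a..p} \<subseteq> S" using S a0 p by (auto simp: image_subset_iff)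
        then show "(\<lambda>t. G (\<gamma> t) (vector_derivative \<gamma> (at t))) integrable_on {a..p}"
          using piecewise_smooth_curve_piece(4)[OF a(2) g, of S G] G by simp
      qed (use a0 a in auto)
      ultimately show ?thesis by blast
    next
      case True
      then show ?thesis
        using integrable_on_refl[of "f :: real \<Rightarrow> real" "0 :: real" for f] by simp
    qed
  qed
  show thesis
  proof (rule that[of P])
    show "finite P" by (rule P(1))
    show "(\<gamma> has_vector_derivative vector_derivative \<gamma> (at t)) (at t)" if "t \<in> {0..1} - P" for t
      using that by (rule deriv)
    have "1 \<in> P" using P(2) by simp
    note step[OF this]
    then show "continuous_on {0..1} \<gamma>" by blast
    show "(\<lambda>t. G (\<gamma> t) (vector_derivative \<gamma> (at t))) integrable_on {0..1}"
      if "continuous_on (S \<times> UNIV) (\<lambda>(x, v). G x v)" "\<gamma> ` {0..1} \<subseteq> S"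
      for G :: "'a \<Rightarrow> 'a \<Rightarrow> real" and S
      using step[OF \<open>1 \<in> P\<close>] that by blast
  qed
qed

lemma continuous_on_hinner [continuous_intros]:
  assumes "continuous_on S f" "continuous_on S g"
  shows "continuous_on S (\<lambda>x. hinner (f x) (g x))"
  unfolding hinner_def by (intro continuous_intros assms)

lemma continuous_on_bergman_speed:
  "continuous_on (unit_ball \<times> UNIV) (\<lambda>(x :: complex ^ 'n, v). sqrt (Re (hinner (bergman_matrix x *v v) v)))"
proof -
  have "1 - (norm x)\<^sup>2 \<noteq> 0" if "norm x < 1" for x :: "complex ^ 'n"
    using power_less_one_iff[of "norm x" 2] that by simp
  then show ?thesis
    unfolding bergman_form split_beta by (intro continuous_intros) auto
qed

lemma continuous_on_cosh_bergman:
  fixes w :: "complex ^ 'n"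
  assumes "norm w < 1"
  shows "continuous_on unit_ball (cosh_bergman w)"
proof -
  have "(1 - (norm x)\<^sup>2) * (1 - (norm w)\<^sup>2) \<noteq> 0" if "norm x < 1" for x :: "complex ^ 'n"
    using power_less_one_iff[of "norm x" 2] power_less_one_iff[of "norm w" 2] that assms by simp
  then show ?thesis
    unfolding cosh_bergman_def by (intro continuous_intros) auto
qed

text \<open>If \<open>d\<close> is the derivative of \<open>ln C\<close>, then \<open>C * d\<close>
  is that of \<open>C\<close> and the quotient is that of \<open>arcosh C\<close>. The bound follows
  because \<open>C\<^sup>2 * (1 - 1 / C\<^sup>2) = C\<^sup>2 - 1\<close>.\<close>

lemma arcosh_derivative_bound:
  fixes C d q :: real
  assumes C: "C > 1" and le: "d\<^sup>2 \<le> (1 - 1 / C\<^sup>2) * q"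
  shows "\<bar>(C * d) / sqrt (C\<^sup>2 - 1)\<bar> \<le> sqrt q"
proof (rule real_le_rsqrt)
  have C2: "C\<^sup>2 > 1" using C by (simp add: one_less_power)
  have "C\<^sup>2 * d\<^sup>2 \<le> C\<^sup>2 * ((1 - 1 / C\<^sup>2) * q)"
    using le by (intro mult_left_mono) auto
  also have "\<dots> = (C\<^sup>2 - 1) * q" using C by (simp add: algebra_simps)
  finally show "\<bar>(C * d) / sqrt (C\<^sup>2 - 1)\<bar>\<^sup>2 \<le> q"
    using C2 by (simp add: power_divide power_mult_distrib divide_le_eq mult.commute)
qed

text \<open>
  The arcosh is not differentiable at \<open>1\<close>, so the speed is compared with the derivative of
  \<open>arcosh (cosh_bergman w (\<gamma> t))\<close> only up to the first time at which the curve reaches \<open>w\<close>.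
\<close>

lemma arcosh_le_bergman_length:
  fixes \<gamma> :: "real \<Rightarrow> complex ^ 'n"
  assumes \<gamma>: "piecewise_smooth_curve \<gamma>" and ball: "\<gamma> ` {0..1} \<subseteq> unit_ball"
    and w: "\<gamma> 1 = w"
  shows "arcosh (cosh_bergman w (\<gamma> 0)) \<le> bergman_length \<gamma>"
proof -
  define C where "C t = cosh_bergman w (\<gamma> t)" for t
  define v where "v t = vector_derivative \<gamma> (at t)" for t
  define sp where "sp t = sqrt (Re (hinner (bergman_matrix (\<gamma> t) *v v t) (v t)))" for t
  define L where "L t = v t \<bullet> ((1 / of_real (1 - (norm (\<gamma> t))\<^sup>2)) *s \<gamma> t -
    (1 / (1 - hinner w (\<gamma> t))) *s w)" for t
  obtain P where P: "finite P"
    and d0: "\<And>t. t \<in> {0..1} - P \<Longrightarrow> (\<gamma> has_vector_derivative vector_derivative \<gamma> (at t)) (at t)"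
    and cont: "continuous_on {0..1} \<gamma>"
    and integrable: "\<And>(G :: _ \<Rightarrow> _ \<Rightarrow> real) S. continuous_on (S \<times> UNIV) (\<lambda>(x, v). G x v) \<Longrightarrow>
      \<gamma> ` {0..1} \<subseteq> S \<Longrightarrow> (\<lambda>t. G (\<gamma> t) (vector_derivative \<gamma> (at t))) integrable_on {0..1}"
    by (rule piecewise_smooth_curveE[OF \<gamma>], rule that)
  note d = d0[folded v_def]
  have int: "sp integrable_on {0..1}"
    unfolding sp_def[abs_def] v_def by (rule integrable[OF continuous_on_bergman_speed ball])
  have n1: "norm (\<gamma> t) < 1" if "t \<in> {0..1}" for t
  proof -
    have "\<gamma> t \<in> unit_ball" by (rule subsetD[OF ball imageI[OF that]])
    then show ?thesis by simp
  qed
  have w1: "norm w < 1" using n1[of 1] w by simp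
  have C_ge: "C t \<ge> 1" if "t \<in> {0..1}" for t
    unfolding C_def by (rule cosh_bergman_ge_1[OF n1[OF that] w1])
  have C_cont: "continuous_on {0..1} C"
    unfolding C_def by (rule continuous_on_compose2[OF continuous_on_cosh_bergman[OF w1] cont ball])
  have sp_ge: "sp t \<ge> 0" if "t \<in> {0..1}" for t
    unfolding sp_def bergman_form using n1[OF that] by (simp add: power_le_one)
  have "C 1 = 1"
  proof -
    have k: "1 - (norm w)\<^sup>2 > 0" using w1 by (simp add: power_less_one_iff)
    have "1 - hinner w w = of_real (1 - (norm w)\<^sup>2)" by (simp add: hinner_self)
    then have "norm (1 - hinner w w) = 1 - (norm w)\<^sup>2" using k by (simp only: norm_of_real abs_of_pos)
    then show ?thesis using k by (simp add: C_def w cosh_bergman_def)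
  qed
  \<comment> \<open>These are the times at which arcosh of \<open>C\<close> may fail to be
    differentiable. The set is compact and contains 1, so it has a least element.\<close>
  define T where "T = {t \<in> {0..1}. C t = 1}"
  have "closed T" unfolding T_def
    by (rule continuous_closed_preimage_constant[OF C_cont closed_atLeastAtMost])
  moreover have "bounded T" by (rule bounded_subset[of "{0..1}"]) (auto simp: T_def)
  ultimately have "compact T" by (simp add: compact_eq_bounded_closed)
  moreover have "1 \<in> T" using \<open>C 1 = 1\<close> by (simp add: T_def)
  ultimately obtain t0 where t0: "t0 \<in> T" "\<And>t. t \<in> T \<Longrightarrow> t0 \<le> t"
    using compact_attains_inf[of T] by (metis empty_iff)
  have t01: "t0 \<in> {0..1}" "C t0 = 1" using t0 by (auto simp: T_def)
  have C_gt: "C t > 1" if "t \<in> {0<..<t0}" for t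
  proof -
    have "t \<in> {0..1}" "t \<notin> T" using that t01 t0(2)[of t] by auto
    then show ?thesis using C_ge[of t] by (auto simp: T_def less_le)
  qed
  \<comment> \<open>At the exceptional points \<open>D\<close> takes the value
    \<open>- sp t\<close>, so that \<open>- D t \<le> sp t\<close> holds at every point of the
    interval. They are finitely many and do not affect the integral.\<close>
  define D where "D t = (if t \<in> {0<..<t0} - P then C t * L t / sqrt ((C t)\<^sup>2 - 1) else - sp t)" for t
  have D_le: "- D t \<le> sp t" if t: "t \<in> {0..t0}" for t
  proof (cases "t \<in> {0<..<t0} - P")
    case True
    have "(L t)\<^sup>2 \<le> (1 - 1 / (C t)\<^sup>2) * Re (hinner (bergman_matrix (\<gamma> t) *v v t) (v t))"
      unfolding L_def C_def using t t01
      by (intro log_derivative_cosh_bergman_bound n1 w1) auto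
    from arcosh_derivative_bound[OF C_gt this] True
    have "\<bar>C t * L t / sqrt ((C t)\<^sup>2 - 1)\<bar> \<le> sp t" by (simp only: sp_def Diff_iff)
    from abs_le_D2[OF this] show ?thesis using True by (simp add: D_def)
  qed (auto simp: D_def)
  have "(D has_integral arcosh (C t0) - arcosh (C 0)) {0..t0}"
  proof (rule fundamental_theorem_of_calculus_interior_strong[OF P])
    fix t assume t: "t \<in> {0<..<t0} - P"
    then have t1: "t \<in> {0..1}" "t \<in> {0..1} - P" using t01 by auto
    have ln: "((\<lambda>t. ln (C t)) has_real_derivative L t) (at t)"
      unfolding C_def L_def by (rule has_real_derivative_ln_cosh_bergman[OF n1[OF t1(1)] w1 d[OF t1(2)]])
    have "((\<lambda>t. exp (ln (C t))) has_real_derivative C t * L t) (at t)"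
      using DERIV_chain2[OF DERIV_exp ln] C_ge[OF t1(1)] by simp
    moreover have "\<forall>\<^sub>F s in nhds t. exp (ln (C s)) = C s"
    proof -
      have "\<forall>\<^sub>F s in nhds t. s \<in> {0<..<t0}" using t by (intro eventually_nhds_in_open) auto
      then show ?thesis
      proof eventually_elim
        case (elim s)
        then show ?case using C_gt[of s] by simp
      qed
    qed
    ultimately have "(C has_real_derivative C t * L t) (at t)"
      using DERIV_cong_ev[OF refl _ refl, of "\<lambda>s. exp (ln (C s))" C t] by simp
    from DERIV_chain2[OF arcosh_real_has_field_derivative this] C_gt[of t] t
    have "((\<lambda>t. arcosh (C t)) has_real_derivative D t) (at t)"
      by (simp add: D_def)
    then show "((\<lambda>t. arcosh (C t)) has_vector_derivative D t) (at t)"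
      by (simp add: has_real_derivative_iff_has_vector_derivative)
  next
    show "continuous_on {0..t0} (\<lambda>t. arcosh (C t))"
      using C_ge t01 by (intro continuous_on_arcosh' continuous_on_subset[OF C_cont]) auto
  qed (use t01 in auto)
  \<comment> \<open>The contribution at \<open>t0\<close> vanishes, since
    \<open>arcosh 1 = 0\<close>.\<close>
  from has_integral_neg[OF this] have "((\<lambda>t. - D t) has_integral arcosh (C 0)) {0..t0}"
    using t01 by simp
  moreover have int0: "sp integrable_on {0..t0}"
    using t01 by (intro integrable_on_subinterval[OF int]) auto
  ultimately have "arcosh (C 0) \<le> integral {0..t0} sp"
    using D_le has_integral_le[OF _ integrable_integral] by blast
  also have "\<dots> \<le> integral {0..1} sp"
    using t01 sp_ge by (intro integral_subset_le int int0) auto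
  finally show ?thesis
    by (simp add: C_def sp_def[abs_def] v_def bergman_length_def)
qed

lemma arcosh_le_bergman_dist:
  assumes u: "norm u < 1" and w: "norm w < 1"
  shows "arcosh (cosh_bergman w u) \<le> bergman_dist u w"
  unfolding bergman_dist_def
proof (rule cInf_greatest)
  \<comment> \<open>The straight segment shows that the set of lengths is nonempty, without which
    its infimum would be an unspecified real number.\<close>
  define \<gamma> where "\<gamma> t = u + t *\<^sub>R (w - u)" for t
  have "(\<gamma> has_vector_derivative w - u) (at t within S)" for t S
    unfolding \<gamma>_def[abs_def] by (auto intro!: derivative_eq_intros)
  then have "piecewise_smooth_curve \<gamma>"
    unfolding piecewise_smooth_curve_def
    by (intro exI[of _ "{0, 1}"] conjI ballI impI exI[of _ "\<lambda>_. w - u"] continuous_on_const) auto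
  moreover have "\<gamma> ` {0..1} \<subseteq> unit_ball"
  proof
    fix x assume "x \<in> \<gamma> ` {0..1}"
    then obtain t where t: "t \<in> {0..1}" "x = (1 - t) *\<^sub>R u + t *\<^sub>R w"
      by (auto simp: \<gamma>_def algebra_simps)
    then show "x \<in> unit_ball" using u w convexD_alt[OF convex_ball, of u 0 1 w t] by simp
  qed
  moreover have "\<gamma> 0 = u" "\<gamma> 1 = w" by (simp_all add: \<gamma>_def)
  ultimately have "bergman_length \<gamma> \<in> {bergman_length \<gamma> | \<gamma>. piecewise_smooth_curve \<gamma> \<and>
      \<gamma> ` {0..1} \<subseteq> unit_ball \<and> \<gamma> 0 = u \<and> \<gamma> 1 = w}"
    by (intro CollectI exI[of _ \<gamma>] conjI refl)
  then show "{bergman_length \<gamma> | \<gamma>. piecewise_smooth_curve \<gamma> \<and> \<gamma> ` {0..1} \<subseteq> unit_ball \<and>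
      \<gamma> 0 = u \<and> \<gamma> 1 = w} \<noteq> {}"
    by (metis empty_iff)
  fix x
  assume "x \<in> {bergman_length \<gamma> | \<gamma>. piecewise_smooth_curve \<gamma> \<and> \<gamma> ` {0..1} \<subseteq> unit_ball \<and>
      \<gamma> 0 = u \<and> \<gamma> 1 = w}"
  then obtain \<gamma> where "x = bergman_length \<gamma>" "piecewise_smooth_curve \<gamma>"
      "\<gamma> ` {0..1} \<subseteq> unit_ball" "\<gamma> 0 = u" "\<gamma> 1 = w"
    by (elim CollectE exE conjE)
  then show "arcosh (cosh_bergman w u) \<le> x"
    using arcosh_le_bergman_length[of \<gamma> w] by simp
qed

text \<open>The squared tanh of \<open>arcosh c\<close> is \<open>1 - 1 / c\<^sup>2\<close>, and
  tanh is increasing; so the lower bound for the distance turns a small tanh into a lower bound for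
  \<open>1 / c\<^sup>2\<close>, which is the quotient on the right.\<close>

lemma tanh_bergman_dist_less:
  assumes u: "norm u < 1" and w: "norm w < 1" and less: "tanh (bergman_dist u w) < \<rho>"
  shows "1 - \<rho>\<^sup>2 \<le> (1 - (norm u)\<^sup>2) * (1 - (norm w)\<^sup>2) / (norm (1 - hinner u w))\<^sup>2"
proof -
  define c where "c = cosh_bergman w u"
  have c: "c \<ge> 1" unfolding c_def by (rule cosh_bergman_ge_1[OF u w])
  then have c2: "c\<^sup>2 \<ge> 1" by (simp add: one_le_power)
  have "tanh (arcosh c) \<le> tanh (bergman_dist u w)"
    using arcosh_le_bergman_dist[OF u w] by (simp add: c_def)
  then have "tanh (arcosh c) < \<rho>" using less by (rule le_less_trans)
  then have "(tanh (arcosh c))\<^sup>2 \<le> \<rho>\<^sup>2"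
    using c by (intro power_mono) auto
  moreover have "(tanh (arcosh c))\<^sup>2 = 1 - 1 / c\<^sup>2"
    using c c2 by (simp add: tanh_def sinh_arcosh_real power_divide diff_divide_distrib)
  moreover have "1 / c\<^sup>2 = (1 - (norm u)\<^sup>2) * (1 - (norm w)\<^sup>2) / (norm (1 - hinner u w))\<^sup>2"
    using u w by (simp add: c_def cosh_bergman_def power_divide power_le_one)
  ultimately show ?thesis by simp
qed

section \<open>Decomposition of pluriharmonic maps\<close>

lemma smult_eq_scaleR: "c *s v = Re c *\<^sub>R v + Im c *\<^sub>R (\<i> *s v)" for v :: "complex ^ 'n"
  by (simp add: vec_eq_iff complex_eq_iff)

lemma smult_scaleR: "c *s (r *\<^sub>R v) = r *\<^sub>R (c *s v)" for v :: "complex ^ 'n"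
  by (simp add: vec_eq_iff)

lemma complex_linear_funI:
  fixes L :: "complex ^ 'n \<Rightarrow> complex"
  assumes "linear L" "\<And>v. L (\<i> *s v) = \<i> * L v"
  shows "L (c *s v) = c * L v"
  unfolding smult_eq_scaleR[of c v] linear_add[OF assms(1)] linear_scale[OF assms(1)] assms(2)
  by (simp add: complex_eq_iff)

lemma complex_linear_mapI:
  fixes L :: "complex ^ 'n \<Rightarrow> complex ^ 'm"
  assumes "linear L" "\<And>v. L (\<i> *s v) = \<i> *s L v"
  shows "matrix L *v v = L v"
proof -
  have "L (c *s v) = c *s L v" for c v
    unfolding smult_eq_scaleR[of c] linear_add[OF assms(1)] linear_scale[OF assms(1)] assms(2) ..
  then have "Vector_Spaces.linear (*s) (*s) L"
    using linear_add[OF assms(1)] by unfold_locales (simp_all add: algebra_simps)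
  then show ?thesis by (rule matrix_works)
qed

lemma bounded_linear_smult: "bounded_linear (\<lambda>v :: complex ^ 'n. c *s v)"
  unfolding linear_conv_bounded_linear[symmetric]
  by (simp add: linear_iff vec_eq_iff algebra_simps)

lemma bounded_linear_vcnj: "bounded_linear vcnj"
  unfolding linear_conv_bounded_linear[symmetric]
  by (simp add: linear_iff vec_eq_iff vcnj_def)

lemma vcnj_vcnj [simp]: "vcnj (vcnj v) = v"
  by (simp add: vec_eq_iff vcnj_def)

lemma vcnj_0 [simp]: "vcnj 0 = 0"
  by (simp add: vec_eq_iff vcnj_def)

lemma wirtinger_eq:
  assumes "(u has_derivative L) (at z)"
  shows "wirtinger i u z = (L (axis i 1) - \<i> * L (axis i \<i>)) / 2"
    and "wirtinger_bar i u z = (L (axis i 1) + \<i> * L (axis i \<i>)) / 2"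
  unfolding wirtinger_def wirtinger_bar_def frechet_derivative_at[OF assms, symmetric] by simp_all

lemma axis_ii: "axis i \<i> = \<i> *s axis i (1 :: complex)"
  by (simp add: vec_eq_iff axis_def)

text \<open>The mixed Wirtinger derivatives form a sesquilinear map \<open>Q\<close> that vanishes
  on the standard basis, hence everywhere. The last two relations come from comparing
  \<open>Q a b = 0\<close> with \<open>Q b a = 0\<close> by means of the symmetry of the second
  derivative.\<close>

lemma pluriharmonic_second_derivative:
  fixes f :: "complex ^ 'n \<Rightarrow> complex ^ 'n"
  assumes f': "\<And>z. z \<in> unit_ball \<Longrightarrow> (f has_derivative blinfun_apply (f' z)) (at z)"
    and f'': "\<And>z. z \<in> unit_ball \<Longrightarrow> (f' has_derivative blinfun_apply (f'' z)) (at z)"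
    and cont: "continuous_on unit_ball f''"
    and ph: "\<And>z i j k. z \<in> unit_ball \<Longrightarrow> wirtinger i (wirtinger_bar j (\<lambda>x. f x $ k)) z = 0"
    and z: "z \<in> unit_ball"
  shows "f'' z a b = f'' z b a" "f'' z (\<i> *s a) (\<i> *s b) = - f'' z a b"
    "f'' z a (\<i> *s b) = f'' z (\<i> *s a) b"
proof -
  define S where "S a b = f'' z a b" for a b
  have sym: "S a b = S b a" for a b
    unfolding S_def by (rule second_derivative_symmetric[OF open_ball z f' f'' cont])
  \<comment> \<open>Four times the second derivative of \<open>f\<close>, holomorphic in the
    direction \<open>a\<close> and antiholomorphic in the direction \<open>b\<close>.\<close>
  define Q where "Q a b = S a b + \<i> *s S a (\<i> *s b) - \<i> *s S (\<i> *s a) b + S (\<i> *s a) (\<i> *s b)" for a b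
  have ii: "\<i> *s (\<i> *s v) = - v" for v :: "complex ^ 'n" by (simp add: vec_eq_iff)
  have Smin: "S (- x) y = - S x y" "S x (- y) = - S x y" for x y
    by (simp_all add: S_def blinfun.bilinear_simps)
  have lin: "linear (\<lambda>a. Q a b)" "linear (Q a)" for a b
    unfolding Q_def S_def linear_iff
    by (auto simp: blinfun.bilinear_simps vector_add_ldistrib smult_scaleR algebra_simps)
  have Qi: "Q (\<i> *s a) b = \<i> *s Q a b" "Q a (\<i> *s b) = - \<i> *s Q a b" for a b
    by (simp_all add: Q_def ii Smin vec_eq_iff algebra_simps)
  have basis: "Q (axis i 1) (axis j 1) = 0" for i j
  proof -
    have "Q (axis i 1) (axis j 1) $ k = 0" for k
    proof -
      let ?W = "\<lambda>x. (f' x (axis j 1) $ k + \<i> * f' x (axis j \<i>) $ k) / 2"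
      have "((\<lambda>x. f x $ k) has_derivative (\<lambda>v. f' x v $ k)) (at x)" if "x \<in> unit_ball" for x
        using bounded_linear.has_derivative[OF bounded_linear_vec_nth f'[OF that]] .
      then have W: "wirtinger_bar j (\<lambda>x. f x $ k) x = ?W x" if "x \<in> unit_ball" for x
        using wirtinger_eq(2) that by blast
      have "((\<lambda>x. f' x b $ k) has_derivative (\<lambda>a. S a b $ k)) (at z)" for b
      proof -
        have "((\<lambda>x. f' x b) has_derivative (\<lambda>a. S a b)) (at z)"
          unfolding S_def
          by (rule bounded_linear.has_derivative[OF blinfun.bounded_linear_left f''[OF z]])
        then show ?thesis
          by (rule bounded_linear.has_derivative[OF bounded_linear_vec_nth])
      qed
      then have "(?W has_derivative (\<lambda>a. (S a (axis j 1) $ k + \<i> * S a (axis j \<i>) $ k) / 2)) (at z)"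
        by (auto intro!: derivative_eq_intros)
      then have "(wirtinger_bar j (\<lambda>x. f x $ k) has_derivative
          (\<lambda>a. (S a (axis j 1) $ k + \<i> * S a (axis j \<i>) $ k) / 2)) (at z)"
        by (rule has_derivative_transform_within_open[OF _ open_ball z]) (simp add: W)
      from wirtinger_eq(1)[OF this, of i] ph[OF z, of i j k]
      have "((S (axis i 1) (axis j 1) $ k + \<i> * S (axis i 1) (axis j \<i>) $ k) / 2 -
          \<i> * ((S (axis i \<i>) (axis j 1) $ k + \<i> * S (axis i \<i>) (axis j \<i>) $ k) / 2)) / 2 = 0"
        by (simp only:)
      moreover have "((A + \<i> * B) / 2 - \<i> * ((C + \<i> * D) / 2)) / 2 = (A + \<i> * B - \<i> * C + D) / 4"
        for A B C D :: complex
        by (simp add: field_simps)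
      ultimately have "(S (axis i 1) (axis j 1) $ k + \<i> * S (axis i 1) (axis j \<i>) $ k -
          \<i> * S (axis i \<i>) (axis j 1) $ k + S (axis i \<i>) (axis j \<i>) $ k) / 4 = 0"
        by (simp only:)
      then show ?thesis
        by (simp add: Q_def axis_ii)
    qed
    then show ?thesis by (simp add: vec_eq_iff)
  qed
  have Q_axis: "Q a (axis j 1) = 0" for a j
  proof -
    have "matrix (\<lambda>a. Q a (axis j 1)) *v a = Q a (axis j 1)"
      by (rule complex_linear_mapI) (simp_all add: lin Qi)
    moreover have "matrix (\<lambda>a. Q a (axis j 1)) = 0"
      by (simp add: matrix_def basis vec_eq_iff)
    ultimately show ?thesis by simp
  qed
  \<comment> \<open>\<open>Q\<close> is conjugate-linear in \<open>b\<close>; its conjugate is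
    complex-linear, so vanishing on the basis suffices here too.\<close>
  have vQ: "vcnj (Q a b) = 0" for a b
  proof -
    have "linear (\<lambda>b. vcnj (Q a b))"
      using linear_compose[OF lin(2) bounded_linear.linear[OF bounded_linear_vcnj]] by (simp add: o_def)
    then have "matrix (\<lambda>b. vcnj (Q a b)) *v b = vcnj (Q a b)"
      by (rule complex_linear_mapI) (simp add: Qi vcnj_def vec_eq_iff)
    moreover have "matrix (\<lambda>b. vcnj (Q a b)) = 0"
      by (simp add: matrix_def Q_axis vec_eq_iff)
    ultimately show ?thesis by simp
  qed
  have Q0: "Q a b = 0" for a b
    using vQ[of a b] by (metis vcnj_vcnj vcnj_0)
  have 1: "S a b $ k + \<i> * S a (\<i> *s b) $ k - \<i> * S (\<i> *s a) b $ k + S (\<i> *s a) (\<i> *s b) $ k = 0" for k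
    using arg_cong[OF Q0[of a b], of "\<lambda>v. v $ k"] by (simp add: Q_def)
  have 2: "S a b $ k + \<i> * S (\<i> *s a) b $ k - \<i> * S a (\<i> *s b) $ k + S (\<i> *s a) (\<i> *s b) $ k = 0" for k
    using arg_cong[OF Q0[of b a], of "\<lambda>v. v $ k"]
    by (simp add: Q_def sym[of b] sym[of "\<i> *s b"])
  show "f'' z a b = f'' z b a" using sym by (simp add: S_def)
  have "S (\<i> *s a) (\<i> *s b) $ k = - S a b $ k" for k
    using 1[of k] 2[of k] by (simp add: complex_eq_iff)
  then show "f'' z (\<i> *s a) (\<i> *s b) = - f'' z a b" by (simp add: vec_eq_iff S_def)
  have "S a (\<i> *s b) $ k = S (\<i> *s a) b $ k" for k
    using 1[of k] 2[of k] by (simp add: complex_eq_iff)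
  then show "f'' z a (\<i> *s b) = f'' z (\<i> *s a) b" by (simp add: vec_eq_iff S_def)
qed

lemma cjacobian_nth:
  assumes "(h has_derivative L) (at z)"
  shows "cjacobian h z $ k $ j = L (axis j 1) $ k"
  by (simp add: cjacobian_def matrix_def frechet_derivative_at[OF assms, symmetric])

text \<open>The complex-linear part \<omega> of \<open>f'\<close> is a closed one-form, so it has a
  primitive \<open>H\<close>, which is holomorphic. The derivative of \<open>f - H\<close> is
  conjugate-linear, so its conjugate gives \<open>g\<close>. Complex linearity of the derivatives of
  the Jacobian entries is read off from \<open>f''\<close>.\<close>

lemma pluriharmonic_decomposition:
  fixes f :: "complex ^ 'n \<Rightarrow> complex ^ 'n"
  assumes "pluriharmonic f"
  obtains h g where "canonical_decomposition f h g"
    "\<And>k j. holomorphic_fun_on (\<lambda>z. cjacobian h z $ k $ j) unit_ball"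
    "\<And>k j. holomorphic_fun_on (\<lambda>z. cjacobian g z $ k $ j) unit_ball"
proof -
  from assms obtain f' f'' where
    f': "\<And>z. z \<in> unit_ball \<Longrightarrow> (f has_derivative blinfun_apply (f' z)) (at z)"
    and f'': "\<And>z. z \<in> unit_ball \<Longrightarrow> (f' has_derivative blinfun_apply (f'' z)) (at z)"
    and cont: "continuous_on unit_ball f''"
    and ph: "\<And>z i j k. z \<in> unit_ball \<Longrightarrow> wirtinger i (wirtinger_bar j (\<lambda>x. f x $ k)) z = 0"
    unfolding pluriharmonic_def C2_on_def by blast
  have S: "f'' z a b = f'' z b a" "f'' z (\<i> *s a) (\<i> *s b) = - f'' z a b"
    "f'' z a (\<i> *s b) = f'' z (\<i> *s a) b" if "z \<in> unit_ball" for z a b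
    using pluriharmonic_second_derivative[OF f' f'' cont ph that] by simp_all
  define J where "J = Blinfun (\<lambda>v :: complex ^ 'n. \<i> *s v)"
  have J: "blinfun_apply J v = \<i> *s v" for v
    unfolding J_def by (simp add: bounded_linear_Blinfun_apply bounded_linear_smult)
  have ii: "\<i> *s (\<i> *s v) = - v" for v :: "complex ^ 'n" by (simp add: vec_eq_iff)
  \<comment> \<open>The projection of a real-linear map onto its complex-linear part, as a bounded
    operator, so that it commutes with differentiation.\<close>
  define T where "T = Blinfun (\<lambda>A. (1 / 2) *\<^sub>R (A - (J o\<^sub>L (A o\<^sub>L J))))"
  have T: "blinfun_apply T A v = (1 / 2) *\<^sub>R (A v - \<i> *s A (\<i> *s v))" for A v
  proof -
    have "bounded_linear (\<lambda>A. (1 / 2) *\<^sub>R (A - (J o\<^sub>L (A o\<^sub>L J))))"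
      by (intro bounded_linear_intros)
    then show ?thesis
      unfolding T_def
      by (simp only: bounded_linear_Blinfun_apply blinfun.scaleR_left blinfun.diff_left
          blinfun_apply_blinfun_compose J)
  qed
  define \<omega> where "\<omega> z = T (f' z)" for z
  define \<omega>' where "\<omega>' z = T o\<^sub>L f'' z" for z
  have \<omega>_i: "\<omega> z (\<i> *s v) = \<i> *s \<omega> z v" for z v
    by (simp add: \<omega>_def T ii blinfun.bilinear_simps) (simp add: vec_eq_iff algebra_simps)
  have \<omega>: "(\<omega> has_derivative blinfun_apply (\<omega>' z)) (at z)" if "z \<in> unit_ball" for z
    unfolding \<omega>_def[abs_def] \<omega>'_def blinfun_apply_blinfun_compose
    using bounded_linear.has_derivative[OF blinfun.bounded_linear_right f''[OF that]] .
  have \<omega>': "\<omega>' z a b = (1 / 2) *\<^sub>R (f'' z a b - \<i> *s f'' z a (\<i> *s b))" for z a b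
    by (simp add: \<omega>'_def T)
  \<comment> \<open>Complex linearity in the direction in which the base point moves; this is what
    makes the Jacobian entries of \<open>h\<close> holomorphic.\<close>
  have \<omega>'_i: "\<omega>' z (\<i> *s a) b = \<i> *s \<omega>' z a b" if "z \<in> unit_ball" for z a b
    using S(2,3)[OF that] unfolding \<omega>' by (simp add: vec_eq_iff algebra_simps)
  have "\<omega>' z a b = \<omega>' z b a" if "z \<in> unit_ball" for z a b
    using S(1,3)[OF that] unfolding \<omega>' by metis
  moreover have "continuous_on unit_ball \<omega>'"
    unfolding \<omega>'_def[abs_def] by (intro continuous_intros cont)
  ultimately obtain H where H: "\<And>z. z \<in> unit_ball \<Longrightarrow> (H has_derivative blinfun_apply (\<omega> z)) (at z)"
    using closed_one_form_exact[OF open_ball convex_ball _ \<omega>] by (metis centre_in_ball zero_less_one)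
  \<comment> \<open>This constant achieves the normalization \<open>g 0 = 0\<close>.\<close>
  define c where "c = f 0 - H 0"
  define h where "h z = H z + c" for z
  define g where "g z = vcnj (f z - H z - c)" for z
  define \<eta> where "\<eta> z v = vcnj (f' z v - \<omega> z v)" for z v
  have h: "(h has_derivative blinfun_apply (\<omega> z)) (at z)" if "z \<in> unit_ball" for z
    unfolding h_def[abs_def] using has_derivative_add[OF H[OF that] has_derivative_const] by simp
  have g: "(g has_derivative \<eta> z) (at z)" if "z \<in> unit_ball" for z
    unfolding g_def[abs_def] \<eta>_def[abs_def]
    using bounded_linear.has_derivative[OF bounded_linear_vcnj
      has_derivative_diff[OF has_derivative_diff[OF f'[OF that] H[OF that]] has_derivative_const]]
    by simp
  have \<eta>_i: "\<eta> z (\<i> *s v) = \<i> *s \<eta> z v" for z v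
    by (simp add: \<eta>_def \<omega>_def T ii blinfun.bilinear_simps)
       (simp add: vec_eq_iff vcnj_def complex_eq_iff field_simps)
  have "canonical_decomposition f h g"
    unfolding canonical_decomposition_def
  proof (intro conjI ballI)
    show "holomorphic_map_on h unit_ball"
      unfolding holomorphic_map_on_def
    proof
      fix z :: "complex ^ 'n" assume z: "z \<in> unit_ball"
      have "matrix (\<omega> z) *v v = \<omega> z v" for v
        by (rule complex_linear_mapI[OF bounded_linear.linear[OF blinfun.bounded_linear_right] \<omega>_i])
      then have "blinfun_apply (\<omega> z) = (\<lambda>v. matrix (\<omega> z) *v v)" by auto
      then show "\<exists>A. (h has_derivative (\<lambda>v. A *v v)) (at z)" using h[OF z] by metis
    qed
    show "holomorphic_map_on g unit_ball"
      unfolding holomorphic_map_on_def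
    proof
      fix z :: "complex ^ 'n" assume z: "z \<in> unit_ball"
      have "linear (\<eta> z)" using g[OF z] by (rule has_derivative_linear)
      then have "matrix (\<eta> z) *v v = \<eta> z v" for v
        by (rule complex_linear_mapI) (simp add: \<eta>_i)
      then have "\<eta> z = (\<lambda>v. matrix (\<eta> z) *v v)" by auto
      then show "\<exists>A. (g has_derivative (\<lambda>v. A *v v)) (at z)" using g[OF z] by metis
    qed
  qed (simp_all add: g_def h_def c_def)
  moreover have "holomorphic_fun_on (\<lambda>z. cjacobian h z $ k $ j) unit_ball" for k j
    unfolding holomorphic_fun_on_def
  proof (intro ballI exI conjI allI)
    fix z :: "complex ^ 'n" assume z: "z \<in> unit_ball"
    have "((\<lambda>z. \<omega> z (axis j 1) $ k) has_derivative (\<lambda>a. \<omega>' z a (axis j 1) $ k)) (at z)"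
      by (intro bounded_linear.has_derivative[OF bounded_linear_vec_nth]
          bounded_linear.has_derivative[OF blinfun.bounded_linear_left] \<omega> z)
    then show *: "((\<lambda>z. cjacobian h z $ k $ j) has_derivative (\<lambda>a. \<omega>' z a (axis j 1) $ k)) (at z)"
      by (rule has_derivative_transform_within_open[OF _ open_ball z]) (simp add: cjacobian_nth[OF h])
    show "\<omega>' z (c *s v) (axis j 1) $ k = c * \<omega>' z v (axis j 1) $ k" for c v
      by (rule complex_linear_funI[where L = "\<lambda>a. \<omega>' z a (axis j 1) $ k", OF has_derivative_linear[OF *]])
         (simp add: \<omega>'_i[OF z])
  qed
  moreover have "holomorphic_fun_on (\<lambda>z. cjacobian g z $ k $ j) unit_ball" for k j
    unfolding holomorphic_fun_on_def
  proof (intro ballI exI conjI allI)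
    fix z :: "complex ^ 'n" assume z: "z \<in> unit_ball"
    let ?L = "\<lambda>a. vcnj (f'' z a (axis j 1) - \<omega>' z a (axis j 1)) $ k"
    have "((\<lambda>z. \<eta> z (axis j 1) $ k) has_derivative ?L) (at z)"
      unfolding \<eta>_def
      by (intro bounded_linear.has_derivative[OF bounded_linear_vec_nth]
          bounded_linear.has_derivative[OF bounded_linear_vcnj] has_derivative_diff
          bounded_linear.has_derivative[OF blinfun.bounded_linear_left] \<omega> f'' z)
    then show *: "((\<lambda>z. cjacobian g z $ k $ j) has_derivative ?L) (at z)"
      by (rule has_derivative_transform_within_open[OF _ open_ball z]) (simp add: cjacobian_nth[OF g])
    \<comment> \<open>The conjugate-linear part of \<open>f'\<close> also depends
      antiholomorphically on the base point; conjugation then makes the Jacobian entries of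
      \<open>g\<close> holomorphic.\<close>
    have conj_lin: "f'' z (\<i> *s a) b - \<omega>' z (\<i> *s a) b = - \<i> *s (f'' z a b - \<omega>' z a b)" for a b
    proof -
      have w: "2 * \<omega>' z a b $ k = f'' z a b $ k - \<i> * f'' z (\<i> *s a) b $ k" for k
        unfolding \<omega>' S(3)[OF z] by (simp add: complex_eq_iff)
      have "f'' z (\<i> *s a) b $ k - \<i> * \<omega>' z a b $ k = - \<i> * (f'' z a b $ k - \<omega>' z a b $ k)" for k
        using w[of k] by (simp add: complex_eq_iff)
      then show ?thesis unfolding \<omega>'_i[OF z] by (simp add: vec_eq_iff algebra_simps)
    qed
    show "?L (c *s v) = c * ?L v" for c v
    proof (rule complex_linear_funI[where L = ?L, OF has_derivative_linear[OF *]])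
      show "?L (\<i> *s v) = \<i> * ?L v" for v
        unfolding conj_lin by (simp add: vcnj_def right_diff_distrib)
    qed
  qed
  ultimately show thesis by (rule that)
qed

section \<open>The Bloch prenorm under composition\<close>

lemma holomorphic_fun_on_const: "holomorphic_fun_on (\<lambda>_. c) S"
  unfolding holomorphic_fun_on_def by (intro ballI exI[of _ "\<lambda>_. 0"]) simp

lemma holomorphic_fun_on_add:
  assumes "holomorphic_fun_on F S" "holomorphic_fun_on G S"
  shows "holomorphic_fun_on (\<lambda>z. F z + G z) S"
  unfolding holomorphic_fun_on_def
proof
  fix z assume "z \<in> S"
  then obtain L M where "(F has_derivative L) (at z)" "\<And>c v. L (c *s v) = c * L v"
    "(G has_derivative M) (at z)" "\<And>c v. M (c *s v) = c * M v"
    using assms unfolding holomorphic_fun_on_def by meson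
  then show "\<exists>L. ((\<lambda>z. F z + G z) has_derivative L) (at z) \<and> (\<forall>c v. L (c *s v) = c * L v)"
    by (intro exI[of _ "\<lambda>v. L v + M v"] conjI allI has_derivative_add) (simp_all add: algebra_simps)
qed

lemma holomorphic_fun_on_mult:
  assumes "holomorphic_fun_on F S" "holomorphic_fun_on G S"
  shows "holomorphic_fun_on (\<lambda>z. F z * G z) S"
  unfolding holomorphic_fun_on_def
proof
  fix z assume "z \<in> S"
  then obtain L M where "(F has_derivative L) (at z)" "\<And>c v. L (c *s v) = c * L v"
    "(G has_derivative M) (at z)" "\<And>c v. M (c *s v) = c * M v"
    using assms unfolding holomorphic_fun_on_def by meson
  then show "\<exists>L. ((\<lambda>z. F z * G z) has_derivative L) (at z) \<and> (\<forall>c v. L (c *s v) = c * L v)"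
    by (intro exI[of _ "\<lambda>v. F z * M v + L v * G z"] conjI allI has_derivative_mult)
      (simp_all add: algebra_simps)
qed

lemma holomorphic_fun_on_sum:
  "(\<And>i. i \<in> I \<Longrightarrow> holomorphic_fun_on (F i) S) \<Longrightarrow> holomorphic_fun_on (\<lambda>z. \<Sum>i\<in>I. F i z) S"
  by (induction I rule: infinite_finite_induct)
     (simp_all add: holomorphic_fun_on_const holomorphic_fun_on_add)

lemma holomorphic_fun_on_prod:
  "(\<And>i. i \<in> I \<Longrightarrow> holomorphic_fun_on (F i) S) \<Longrightarrow> holomorphic_fun_on (\<lambda>z. \<Prod>i\<in>I. F i z) S"
  by (induction I rule: infinite_finite_induct)
     (simp_all add: holomorphic_fun_on_const holomorphic_fun_on_mult)

lemma holomorphic_fun_on_det: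
  fixes A :: "complex ^ 'n \<Rightarrow> complex ^ 'm ^ 'm"
  assumes "\<And>i j. holomorphic_fun_on (\<lambda>z. A z $ i $ j) S"
  shows "holomorphic_fun_on (\<lambda>z. det (A z)) S"
  unfolding det_def
  by (intro holomorphic_fun_on_sum holomorphic_fun_on_mult holomorphic_fun_on_prod
      holomorphic_fun_on_const assms)

lemma cjacobian_eq:
  assumes "(h has_derivative (\<lambda>v. A *v v)) (at z)"
  shows "cjacobian h z = A"
  unfolding cjacobian_def frechet_derivative_at[OF assms, symmetric] by simp

lemma holomorphic_map_on_has_derivative:
  assumes "holomorphic_map_on h S" "z \<in> S"
  shows "(h has_derivative (\<lambda>v. cjacobian h z *v v)) (at z)"
  using assms cjacobian_eq unfolding holomorphic_map_on_def by metis

text \<open>Both decompositions give the same derivative of \<open>f\<close>. Evaluating it at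
  \<open>v\<close> and at \<open>\<i> *s v\<close> separates the complex-linear part from the
  conjugate-linear one.\<close>

lemma canonical_decomposition_cjacobian_unique:
  assumes d: "canonical_decomposition f h g" "canonical_decomposition f h' g'" and z: "z \<in> unit_ball"
  shows "cjacobian h z = cjacobian h' z" "cjacobian g z = cjacobian g' z"
proof -
  have f: "(f has_derivative (\<lambda>v. cjacobian h z *v v + vcnj (cjacobian g z *v v))) (at z)"
    if "canonical_decomposition f h g" for h g
  proof -
    have "((\<lambda>z. h z + vcnj (g z)) has_derivative
        (\<lambda>v. cjacobian h z *v v + vcnj (cjacobian g z *v v))) (at z)"
      using that z unfolding canonical_decomposition_def
      by (intro has_derivative_add bounded_linear.has_derivative[OF bounded_linear_vcnj]
          holomorphic_map_on_has_derivative) auto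
    then show ?thesis
      by (rule has_derivative_transform_within_open[OF _ open_ball z])
        (use that in \<open>simp add: canonical_decomposition_def\<close>)
  qed
  have eq: "cjacobian h z *v v + vcnj (cjacobian g z *v v) =
      cjacobian h' z *v v + vcnj (cjacobian g' z *v v)" for v
    using has_derivative_unique[OF f[OF d(1)] f[OF d(2)]] by metis
  have "(cjacobian h z *v v) $ k = (cjacobian h' z *v v) $ k \<and>
      (cjacobian g z *v v) $ k = (cjacobian g' z *v v) $ k" for v k
    using arg_cong[OF eq[of v], of "\<lambda>x. x $ k"] arg_cong[OF eq[of "\<i> *s v"], of "\<lambda>x. x $ k"]
    by (simp add: vcnj_def vec.scale complex_eq_iff)
  then show "cjacobian h z = cjacobian h' z" "cjacobian g z = cjacobian g' z"
    by (simp_all add: matrix_eq vec_eq_iff)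
qed

lemma Lambda_eq:
  assumes "canonical_decomposition f h g" "z \<in> unit_ball"
  shows "Lambda f z = norm (det (cjacobian h z)) + norm (det (cjacobian g z))"
proof -
  obtain h' g' where *: "(SOME (h, g). canonical_decomposition f h g) = (h', g')"
    by (metis surj_pair)
  have "case (SOME (h, g). canonical_decomposition f h g) of (h, g) \<Rightarrow> canonical_decomposition f h g"
    by (rule someI[of _ "(h, g)"]) (use assms in simp)
  then have "canonical_decomposition f h' g'" by (simp add: *)
  from canonical_decomposition_cjacobian_unique[OF assms(1) this assms(2)]
  show ?thesis by (simp add: Lambda_def *)
qed

lemma Lambda_comp_op:
  fixes \<phi> :: "complex ^ 'n \<Rightarrow> complex ^ 'n"
  assumes d: "canonical_decomposition f h g" and \<phi>: "holomorphic_map_on \<phi> unit_ball"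
    and self: "\<phi> ` unit_ball \<subseteq> unit_ball" and z: "z \<in> unit_ball"
  shows "Lambda (comp_op \<phi> f) z = Lambda f (\<phi> z) * norm (det (cjacobian \<phi> z))"
proof -
  \<comment> \<open>The constant that restores the normalization \<open>G 0 = 0\<close> is moved to
    \<open>H\<close> and does not change the Jacobians.\<close>
  define H where "H x = h (\<phi> x) + vcnj (g (\<phi> 0))" for x
  define G where "G x = g (\<phi> x) - g (\<phi> 0)" for x
  have in_ball: "\<phi> x \<in> unit_ball" if "x \<in> unit_ball" for x using self that by blast
  have hol: "holomorphic_map_on h unit_ball" "holomorphic_map_on g unit_ball"
    using d by (auto simp: canonical_decomposition_def)
  have chain: "((\<lambda>x. q (\<phi> x)) has_derivative (\<lambda>v. (cjacobian q (\<phi> x) ** cjacobian \<phi> x) *v v)) (at x)"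
    if "holomorphic_map_on q unit_ball" "x \<in> unit_ball" for q x
    using has_derivative_compose[OF holomorphic_map_on_has_derivative[OF \<phi> that(2)]
      holomorphic_map_on_has_derivative[OF that(1) in_ball[OF that(2)]]]
    by (simp add: matrix_vector_mul_assoc)
  have H: "(H has_derivative (\<lambda>v. (cjacobian h (\<phi> x) ** cjacobian \<phi> x) *v v)) (at x)"
    if "x \<in> unit_ball" for x
    unfolding H_def[abs_def] using has_derivative_add[OF chain[OF hol(1) that] has_derivative_const] by simp
  have G: "(G has_derivative (\<lambda>v. (cjacobian g (\<phi> x) ** cjacobian \<phi> x) *v v)) (at x)"
    if "x \<in> unit_ball" for x
    unfolding G_def[abs_def] using has_derivative_diff[OF chain[OF hol(2) that] has_derivative_const] by simp
  have vd: "vcnj (x - y) = vcnj x - vcnj y" for x y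
    by (simp add: vcnj_def vec_eq_iff)
  have "canonical_decomposition (comp_op \<phi> f) H G"
    unfolding canonical_decomposition_def
  proof (intro conjI ballI)
    show "holomorphic_map_on H unit_ball" "holomorphic_map_on G unit_ball"
      unfolding holomorphic_map_on_def using H G by blast+
    fix x :: "complex ^ 'n" assume "x \<in> unit_ball"
    then have "f (\<phi> x) = h (\<phi> x) + vcnj (g (\<phi> x))"
      using d in_ball unfolding canonical_decomposition_def by blast
    then show "comp_op \<phi> f x = H x + vcnj (G x)"
      by (simp add: comp_op_def H_def G_def vd)
  qed (simp add: G_def)
  from Lambda_eq[OF this z] show ?thesis
    unfolding Lambda_eq[OF d in_ball[OF z]] cjacobian_eq[OF H[OF z]] cjacobian_eq[OF G[OF z]]
    by (simp add: det_mul norm_mult algebra_simps)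
qed

text \<open>The power of \<open>1 - (norm (\<phi> z))\<^sup>2\<close> in the density at
  \<open>\<phi> z\<close> cancels the denominator in \<open>tau\<close>.\<close>

lemma bloch_density_comp_op:
  assumes "canonical_decomposition f h g" "holomorphic_map_on \<phi> unit_ball"
    and self: "\<phi> ` unit_ball \<subseteq> unit_ball" and z: "z \<in> unit_ball"
  shows "bloch_density (comp_op \<phi> f) z = tau \<phi> z * bloch_density f (\<phi> z)"
proof -
  have "\<phi> z \<in> unit_ball" using self z by blast
  then have "1 - (norm (\<phi> z))\<^sup>2 > 0" "1 - (norm z)\<^sup>2 > 0" using z by (auto simp: power_less_one_iff)
  moreover have "Lambda f (\<phi> z) \<ge> 0"
    using Lambda_eq[OF assms(1) \<open>\<phi> z \<in> unit_ball\<close>] by simp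
  ultimately show ?thesis
    by (simp add: bloch_density_def tau_def Lambda_comp_op[OF assms] powr_mult powr_divide)
qed

text \<open>The power of the Bloch density with exponent \<open>CARD('n)\<close>. It is written with
  a natural power of a square root, the form in which the bounds for holomorphic functions are
  stated.\<close>

definition bloch_weight :: "(complex ^ 'n \<Rightarrow> complex ^ 'n) \<Rightarrow> complex ^ 'n \<Rightarrow> real"
  where "bloch_weight f z = sqrt (1 - (norm z)\<^sup>2) ^ (CARD('n) + 1) * Lambda f z"

lemma bloch_density_eq_weight:
  fixes f :: "complex ^ 'n \<Rightarrow> complex ^ 'n"
  assumes "z \<in> unit_ball" "Lambda f z \<ge> 0"
  shows "bloch_density f z = bloch_weight f z powr (1 / real CARD('n))"
proof -
  have k: "1 - (norm z)\<^sup>2 > 0" using assms(1) by (simp add: power_less_one_iff)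
  have "sqrt (1 - (norm z)\<^sup>2) ^ (CARD('n) + 1) = (1 - (norm z)\<^sup>2) powr ((real CARD('n) + 1) / 2)"
    using k by (simp add: powr_half_sqrt[symmetric] powr_realpow[symmetric] powr_powr add.commute del: power_Suc)
  then show ?thesis
    using k assms(2) by (simp add: bloch_density_def bloch_weight_def powr_mult powr_powr)
qed

section \<open>Comparison of the Bloch weight at nearby points\<close>

lemma unimodular_aligning:
  fixes a b :: complex
  obtains c where "norm c = 1" "norm (a + c * b) = norm a + norm b"
proof (cases "a = 0 \<or> b = 0")
  case True
  then show thesis by (intro that[of 1]) auto
next
  case False
  \<comment> \<open>Multiplication by \<open>c\<close> rotates \<open>b\<close> to the argument of
    \<open>a\<close>.\<close>
  define c where "c = (a / of_real (norm a)) * (of_real (norm b) / b)"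
  have "a + c * b = (a / of_real (norm a)) * of_real (norm a + norm b)"
    using False by (simp add: c_def field_simps)
  moreover have "norm (a / of_real (norm a)) = 1" using False by (simp add: norm_divide)
  ultimately have "norm (a + c * b) = norm (of_real (norm a + norm b) :: complex)"
    by (simp only: norm_mult mult_1)
  then have "norm (a + c * b) = norm a + norm b" unfolding norm_of_real by simp
  moreover have "norm c = 1" using False by (simp add: c_def norm_mult norm_divide)
  ultimately show thesis using that by blast
qed

lemma bloch_weight_lower_bound:
  fixes f :: "complex ^ 'n \<Rightarrow> complex ^ 'n"
  assumes f: "pluriharmonic f" and K: "K > 0" and bd: "\<And>z. z \<in> unit_ball \<Longrightarrow> bloch_weight f z \<le> K"
    and u: "u \<in> unit_ball" and w: "w \<in> unit_ball" and \<rho>: "0 \<le> \<rho>" "\<rho> < 1"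
    and less: "tanh (bergman_dist u w) < \<rho>" and s: "0 < s" "s < 1"
  shows "sqrt (1 - \<rho>\<^sup>2) ^ (CARD('n) + 1) *
      (bloch_weight f w / K - \<rho> / (s * sqrt (1 - s\<^sup>2) ^ (CARD('n) + 1))) \<le> 2 * (bloch_weight f u / K)"
proof -
  obtain h g where d: "canonical_decomposition f h g"
    and hol: "\<And>k j. holomorphic_fun_on (\<lambda>z. cjacobian h z $ k $ j) unit_ball"
      "\<And>k j. holomorphic_fun_on (\<lambda>z. cjacobian g z $ k $ j) unit_ball"
    by (rule pluriharmonic_decomposition[OF f]) (rule that)
  define a where "a z = det (cjacobian h z)" for z
  define b where "b z = det (cjacobian g z)" for z
  have L: "Lambda f z = norm (a z) + norm (b z)" if "z \<in> unit_ball" for z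
    unfolding a_def b_def by (rule Lambda_eq[OF d that])
  obtain c where c: "norm c = 1" "norm (a w + c * b w) = norm (a w) + norm (b w)"
    by (rule unimodular_aligning)
  \<comment> \<open>By the choice of \<open>c\<close> the weighted modulus of \<open>F\<close>
    equals \<open>bloch_weight f w / K\<close> at \<open>w\<close>, while elsewhere in the ball it
    is at most \<open>bloch_weight f z / K\<close>.\<close>
  define F where "F z = of_real (1 / K) * (a z + c * b z)" for z
  let ?q = "\<lambda>z :: complex ^ 'n. sqrt (1 - (norm z)\<^sup>2) ^ (CARD('n) + 1)"
  have q: "?q z \<ge> 0" if "z \<in> unit_ball" for z
    using that by (simp add: power_le_one)
  have F_le: "?q z * norm (F z) \<le> bloch_weight f z / K" if z: "z \<in> unit_ball" for z
  proof -
    have "norm (a z + c * b z) \<le> Lambda f z"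
      using norm_triangle_ineq[of "a z" "c * b z"] by (simp add: L[OF z] norm_mult c(1))
    then have "?q z * (norm (a z + c * b z) / K) \<le> ?q z * (Lambda f z / K)"
      using K by (intro mult_left_mono divide_right_mono q[OF z]) auto
    then show ?thesis using K by (simp add: F_def norm_mult norm_divide bloch_weight_def)
  qed
  have F_w: "?q w * norm (F w) = bloch_weight f w / K"
    using K by (simp add: F_def norm_mult norm_divide bloch_weight_def c(2) L[OF w])
  have "sqrt (1 - \<rho>\<^sup>2) ^ (CARD('n) + 1) *
      (?q w * norm (F w) - \<rho> / (s * sqrt (1 - s\<^sup>2) ^ (CARD('n) + 1))) \<le> 2 * (?q u * norm (F u))"
  proof (rule weighted_bound_ball[OF _ _ s _ _ _ \<rho>])
    show "holomorphic_fun_on F unit_ball"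
      unfolding F_def[abs_def] a_def b_def
      by (intro holomorphic_fun_on_add holomorphic_fun_on_mult holomorphic_fun_on_const
          holomorphic_fun_on_det hol)
    show "?q z * norm (F z) \<le> 1" if "norm z < 1" for z
    proof -
      have z: "z \<in> unit_ball" using that by simp
      have "bloch_weight f z / K \<le> 1" using bd[OF z] K by (simp add: divide_le_eq)
      then show ?thesis using F_le[OF z] by linarith
    qed
    show "1 - \<rho>\<^sup>2 \<le> (1 - (norm u)\<^sup>2) * (1 - (norm w)\<^sup>2) / (norm (1 - hinner u w))\<^sup>2"
      using u w less by (intro tanh_bergman_dist_less) auto
  qed (use u w in auto)
  then show ?thesis unfolding F_w using F_le[OF u] by linarith
qed

text \<open>The chosen \<open>s\<close> maximizes \<open>s * sqrt (1 - s\<^sup>2) ^ (n + 1)\<close>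
  on the unit interval: the critical equation is
  \<open>1 - s\<^sup>2 = (n + 1) * s\<^sup>2\<close>.\<close>

lemma M_const_power:
  assumes "n > 0"
  defines "s \<equiv> 1 / sqrt (real n + 2)"
  shows "M_const n ^ n = 1 / (s * sqrt (1 - s\<^sup>2) ^ (n + 1))"
proof -
  have "M_const n ^ n = M_const n powr real n"
    by (rule powr_realpow[symmetric]) (simp add: M_const_def)
  also have "\<dots> = (real n + 2) powr (1 / 2) * ((real n + 2) / (real n + 1)) powr ((real n + 1) / 2)"
    using assms(1) by (simp add: M_const_def powr_mult powr_powr)
  also have "((real n + 2) / (real n + 1)) powr ((real n + 1) / 2) =
      sqrt ((real n + 2) / (real n + 1)) ^ (n + 1)"
    by (simp add: powr_half_sqrt[symmetric] powr_realpow[symmetric] powr_powr add.commute del: power_Suc)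
  also have "(real n + 2) powr (1 / 2) = 1 / s"
    by (simp add: s_def powr_half_sqrt)
  also have "(real n + 2) / (real n + 1) = 1 / (1 - s\<^sup>2)"
    by (simp add: s_def power_divide field_simps)
  finally show ?thesis
    by (simp add: real_sqrt_divide power_divide)
qed

lemma M_const_ge_1: "M_const n \<ge> 1"
  unfolding M_const_def by (intro mult_ge1_I ge_one_powr_ge_zero) auto

theorem theorem3p3:
  fixes r \<epsilon> :: real
  assumes "0 < r" and "r < 1 / M_const CARD('n::finite)" and "0 < \<epsilon>"
  shows "\<exists>k>0. \<forall>\<phi> :: complex ^ 'n \<Rightarrow> complex ^ 'n.
    holomorphic_map_on \<phi> unit_ball \<longrightarrow>
    \<phi> ` unit_ball \<subseteq> unit_ball \<longrightarrow>
    (\<forall>w\<in>unit_ball. \<exists>z\<in>unit_ball.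
        tanh (bergman_dist (\<phi> z) w) < r ^ CARD('n) \<and> tau \<phi> z > \<epsilon>) \<longrightarrow>
    (\<forall>f\<in>bloch_space. bloch_prenorm (comp_op \<phi> f) \<ge> ennreal k * bloch_prenorm f)"
proof -
  let ?n = "CARD('n)"
  define s where "s = 1 / sqrt (real ?n + 2)"
  define \<rho> where "\<rho> = r ^ ?n"
  \<comment> \<open>The loss term in the lower bound for the weight. It equals
    \<open>(r * M_const n) ^ n\<close> with \<open>n = CARD('n)\<close>, so the assumption on
    \<open>r\<close> says exactly that it is below 1.\<close>
  define \<mu> where "\<mu> = \<rho> / (s * sqrt (1 - s\<^sup>2) ^ (?n + 1))"
  have n: "?n > 0" by simp
  have s: "0 < s" "s < 1" by (simp_all add: s_def)
  have rM: "r * M_const ?n < 1"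
    using assms(2) M_const_ge_1[of ?n] by (simp add: less_divide_eq)
  have "\<mu> = (r * M_const ?n) ^ ?n"
    unfolding \<mu>_def \<rho>_def power_mult_distrib M_const_power[OF n] s_def by simp
  then have \<mu>: "0 \<le> \<mu>" "\<mu> < 1"
    using rM assms(1) M_const_ge_1[of ?n] n by (auto simp: power_less_one_iff)
  have "r * 1 \<le> r * M_const ?n" using assms(1) M_const_ge_1[of ?n] by (intro mult_left_mono) auto
  then have "r < 1" using rM by simp
  then have \<rho>: "0 \<le> \<rho>" "\<rho> < 1" using assms(1) n by (auto simp: \<rho>_def power_less_one_iff)
  \<comment> \<open>The 4 combines two halvings: \<open>w\<close> is chosen at the level midway
    between \<mu> and 1, which leaves \<open>(1 - \<mu>) / 2\<close>, and the Schwarz-Pick bound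
    carries a factor 2.\<close>
  define \<kappa> where "\<kappa> = sqrt (1 - \<rho>\<^sup>2) ^ (?n + 1) * ((1 - \<mu>) / 4)"
  have "\<rho>\<^sup>2 < 1" using \<rho> by (simp add: power_less_one_iff)
  then have \<kappa>: "\<kappa> > 0" using \<mu> by (simp add: \<kappa>_def)
  define k where "k = \<epsilon> * \<kappa> powr (1 / ?n)"
  have "k > 0" using \<kappa> assms(3) by (simp add: k_def)
  moreover have "bloch_prenorm (comp_op \<phi> f) \<ge> ennreal k * bloch_prenorm f"
    if \<phi>: "holomorphic_map_on \<phi> unit_ball" and self: "\<phi> ` unit_ball \<subseteq> unit_ball"
      and dense: "\<forall>w\<in>unit_ball. \<exists>z\<in>unit_ball. tanh (bergman_dist (\<phi> z) w) < r ^ ?n \<and> tau \<phi> z > \<epsilon>"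
      and f: "f \<in> bloch_space"
    for \<phi> f :: "complex ^ 'n \<Rightarrow> complex ^ 'n"
  proof -
    have ph: "pluriharmonic f" and fin: "bloch_prenorm f < \<infinity>" using f by (auto simp: bloch_space_def)
    obtain h g where d: "canonical_decomposition f h g"
      by (rule pluriharmonic_decomposition[OF ph])
    have L: "Lambda f z \<ge> 0" if "z \<in> unit_ball" for z
      using Lambda_eq[OF d that] by simp
    have W: "bloch_weight f z \<ge> 0" if "z \<in> unit_ball" for z
      using L[OF that] that by (simp add: bloch_weight_def power_le_one)
    define N where "N = enn2real (bloch_prenorm f)"
    have N: "bloch_prenorm f = ennreal N" "N \<ge> 0" using fin by (simp_all add: N_def)
    show ?thesis
    proof (cases "N = 0")
      case False
      then have N0: "N > 0" using N(2) by simp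
      have dens: "bloch_density f z = bloch_weight f z powr (1 / ?n)" if "z \<in> unit_ball" for z
        by (rule bloch_density_eq_weight[OF that L[OF that]])
      \<comment> \<open>The case \<open>x = 0\<close> rests on \<open>0 powr y = 0\<close> and on
        the exponent being positive.\<close>
      have root: "(x powr (1 / ?n)) ^ ?n = x" if "x \<ge> 0" for x :: real
        using that n by (cases "x = 0") (simp_all add: powr_realpow[symmetric] powr_powr)
      have bd: "bloch_weight f z \<le> N ^ ?n" if "z \<in> unit_ball" for z
      proof -
        have "ennreal (bloch_density f z) \<le> ennreal N"
          unfolding N(1)[symmetric] bloch_prenorm_def using that by (rule SUP_upper)
        then have "bloch_weight f z powr (1 / ?n) \<le> N" using N(2) dens[OF that] by simp
        then have "(bloch_weight f z powr (1 / ?n)) ^ ?n \<le> N ^ ?n" by (intro power_mono) auto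
        then show ?thesis using root[OF W[OF that]] by simp
      qed
      \<comment> \<open>The density is a root of the weight, so the level
        \<open>(1 + \<mu>) / 2\<close> for the weight becomes its root for the density. Being below
        1, it is exceeded, relative to the supremum \<open>N\<close>, at some point
        \<open>w\<close>.\<close>
      have "((1 + \<mu>) / 2) powr (1 / ?n) < 1 powr (1 / ?n)"
        using \<mu> n by (intro powr_less_mono2) auto
      then have "((1 + \<mu>) / 2) powr (1 / ?n) * N < N" using N0 by simp
      then have "ennreal (((1 + \<mu>) / 2) powr (1 / ?n) * N) < bloch_prenorm f"
        unfolding N(1) using N0 by (simp add: ennreal_less_iff)
      then obtain w where w: "w \<in> unit_ball"
        and "ennreal (((1 + \<mu>) / 2) powr (1 / ?n) * N) < ennreal (bloch_density f w)"
        unfolding bloch_prenorm_def less_SUP_iff by blast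
      then have "((1 + \<mu>) / 2) powr (1 / ?n) * N < bloch_weight f w powr (1 / ?n)"
        using N0 dens[OF w] by (simp add: ennreal_less_iff)
      then have "(((1 + \<mu>) / 2) powr (1 / ?n) * N) ^ ?n \<le> (bloch_weight f w powr (1 / ?n)) ^ ?n"
        using N0 by (intro power_mono) auto
      then have Ww: "(1 + \<mu>) / 2 * N ^ ?n \<le> bloch_weight f w"
        using root[of "(1 + \<mu>) / 2"] root[OF W[OF w]] \<mu> by (simp add: power_mult_distrib)
      obtain z where z: "z \<in> unit_ball" "tanh (bergman_dist (\<phi> z) w) < \<rho>" "tau \<phi> z > \<epsilon>"
        using dense w unfolding \<rho>_def by blast
      have u: "\<phi> z \<in> unit_ball" using self z(1) by blast
      have NK: "N ^ ?n > 0" using N0 by simp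
      have "\<kappa> = sqrt (1 - \<rho>\<^sup>2) ^ (?n + 1) * ((1 + \<mu>) / 2 - \<mu>) / 2"
        by (simp add: \<kappa>_def field_simps)
      also have "\<dots> \<le> sqrt (1 - \<rho>\<^sup>2) ^ (?n + 1) * (bloch_weight f w / N ^ ?n - \<mu>) / 2"
        using Ww NK \<open>\<rho>\<^sup>2 < 1\<close> by (intro divide_right_mono mult_left_mono diff_right_mono)
          (auto simp: le_divide_eq)
      also have "\<dots> \<le> bloch_weight f (\<phi> z) / N ^ ?n"
        using bloch_weight_lower_bound[OF ph NK bd u w \<rho> z(2) s] unfolding \<mu>_def by (simp add: mult.commute)
      finally have "\<kappa> * N ^ ?n \<le> bloch_weight f (\<phi> z)" using NK by (simp add: le_divide_eq)
      \<comment> \<open>Taking the root returns from weights to densities, where the bound is again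
        linear in \<open>N\<close>.\<close>
      then have "(\<kappa> * N ^ ?n) powr (1 / ?n) \<le> bloch_density f (\<phi> z)"
        unfolding dens[OF u] using \<kappa> NK by (intro powr_mono2) auto
      moreover have "(\<kappa> * N ^ ?n) powr (1 / ?n) = \<kappa> powr (1 / ?n) * N"
        using \<kappa> N0 n by (simp add: powr_mult powr_realpow[symmetric] powr_powr)
      ultimately have u_le: "\<kappa> powr (1 / ?n) * N \<le> bloch_density f (\<phi> z)" by simp
      have "k * N = \<epsilon> * (\<kappa> powr (1 / ?n) * N)" by (simp add: k_def)
      also have "\<dots> \<le> tau \<phi> z * bloch_density f (\<phi> z)"
        using z(3) assms(3) u_le N0 by (intro mult_mono) auto
      also have "\<dots> = bloch_density (comp_op \<phi> f) z"
        by (rule bloch_density_comp_op[OF d \<phi> self z(1), symmetric])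
      finally have "ennreal (k * N) \<le> ennreal (bloch_density (comp_op \<phi> f) z)"
        by (rule ennreal_leI)
      also have "\<dots> \<le> bloch_prenorm (comp_op \<phi> f)"
        unfolding bloch_prenorm_def using z(1) by (rule SUP_upper)
      finally show ?thesis
        using \<open>k > 0\<close> N by (simp add: ennreal_mult)
    qed (simp add: N)
  qed
  ultimately show ?thesis by blast
qed

end
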